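(* Let $(Q,\lhd)$ be a quandle and $A$ an abelian group. A positive quandle cocycle invariant is symmetric with respect to $0$: for every positive quandle $2$-cocycle $\omega\colon Q\times Q\to A$ and every knot diagram $D$, the multisets $\{\,\mathcal{W}^{pos}_\omega(D,\mathcal{C})\mid\mathcal{C}\in\mathscr{C}_Q(D)\,\}$ and $\{\,-\mathcal{W}^{pos}_\omega(D,\mathcal{C})\mid\mathcal{C}\in\mathscr{C}_Q(D)\,\}$ coincide.
   Context: Quandle: a set $Q$ with operations $\lhd,\widetilde{\lhd}$ such that $(a\lhd b)\lhd c=(a\lhd c)\lhd(b\lhd c)$, $(a\lhd b)\,\widetilde{\lhd}\,b=(a\,\widetilde{\lhd}\,b)\lhd b=a$, $a\lhd a=a$ for all $a,b,c\in Q$. Quandles are assumed nonempty. Knots: "knot" means oriented knot or link in $\mathbb{R}^3$; a knot diagram $D$ is a diagram in $\mathbb{R}^2$ of such a link. Arcs run from undercrossing to undercrossing (or are closed curves). Regions are the connected components of $\mathbb{R}^2\setminus D$. Left and right of an oriented arc are as seen when travelling along it. A $Q$-coloring $\mathcal{C}$ of $D$ assigns an element of $Q$ to each arc such that at each crossing, if the over-arc has color $b$ and the under-arc on the right of the over-arc has color $a$, then the under-arc on the left of the over-arc has color $a\lhd b$. The set of $Q$-colorings is $\mathscr{C}_Q(D)$. The positive $\omega$-weight is $\mathcal{W}^{pos}_\omega(D,\mathcal{C})=\sum_x\varepsilon^{pos}(x)\,\omega(a_x,b_x)$, summed over all crossings $x$, where $b_x$ is the color of the over-arc and $a_x$ the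 color of the under-arc lying on the right of the over-arc. Here one takes the checkerboard (black/white) coloring of the regions of $D$ with the exterior (unbounded) region white, and $\varepsilon^{pos}(x)=+1$ if the two regions swept by rotating the over-strand at $x$ counterclockwise until it meets the under-strand are black, $\varepsilon^{pos}(x)=-1$ if they are white. The positive quandle cocycle invariant is the multiset of these weights over all $\mathcal{C}\in\mathscr{C}_Q(D)$. A positive quandle $2$-cocycle is a map $\omega\colon Q\times Q\to A$ with $\omega(a,a)=0$ and $\omega(a,c)+\omega(a\lhd b,c)=\omega(a\lhd c,b\lhd c)+\omega(a,b)+2\omega(b,c)$ for all $a,b,c\in Q$. Two multisets given as indexed families coincide if there is a bijection of index sets preserving values. *)

theory Defs
  imports "HOL-Analysis.Analysis"
begin

section \<open>Quandles and positive 2-cocycles\<close>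

locale quandle =
  fixes Q :: "'q set"
    and qop :: "'q \<Rightarrow> 'q \<Rightarrow> 'q" (infixl \<open>\<lhd>\<close> 70)
    and qinv :: "'q \<Rightarrow> 'q \<Rightarrow> 'q" (infixl \<open>\<lhd>''\<close> 70)
  assumes nonempty: "Q \<noteq> {}"
    and op_closed: "\<lbrakk>a \<in> Q; b \<in> Q\<rbrakk> \<Longrightarrow> a \<lhd> b \<in> Q"
    and inv_closed: "\<lbrakk>a \<in> Q; b \<in> Q\<rbrakk> \<Longrightarrow> a \<lhd>' b \<in> Q"
    and self_distrib: "\<lbrakk>a \<in> Q; b \<in> Q; c \<in> Q\<rbrakk> \<Longrightarrow> (a \<lhd> b) \<lhd> c = (a \<lhd> c) \<lhd> (b \<lhd> c)"
    and op_inv: "\<lbrakk>a \<in> Q; b \<in> Q\<rbrakk> \<Longrightarrow> (a \<lhd> b) \<lhd>' b = a"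
    and inv_op: "\<lbrakk>a \<in> Q; b \<in> Q\<rbrakk> \<Longrightarrow> (a \<lhd>' b) \<lhd> b = a"
    and idem: "a \<in> Q \<Longrightarrow> a \<lhd> a = a"

definition positive_2_cocycle ::
    "'q set \<Rightarrow> ('q \<Rightarrow> 'q \<Rightarrow> 'q) \<Rightarrow> ('q \<Rightarrow> 'q \<Rightarrow> 'a::ab_group_add) \<Rightarrow> bool" where
  "positive_2_cocycle Q qop \<omega> \<longleftrightarrow>
     (\<forall>a\<in>Q. \<omega> a a = 0) \<and>
     (\<forall>a\<in>Q. \<forall>b\<in>Q. \<forall>c\<in>Q.
        \<omega> a c + \<omega> (qop a b) c
          = \<omega> (qop a c) (qop b c) + \<omega> a b + (\<omega> b c + \<omega> b c))"

section \<open>Link diagrams\<close>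

text \<open>
  An oriented link is given by the list of its components, each one a 1-periodic loop in
  three-space, oriented by its parameter. Three-space is \<open>\<complex> \<times> \<real>\<close>: the first coordinate is the
  plane of the diagram (with the standard orientation of \<open>\<complex>\<close>), and the second one is the height,
  by which over and under are told apart. A diagram is thus recorded by a link together with the
  requirement that its projection to \<open>\<complex>\<close> is regular.
\<close>

type_synonym link = "(real \<Rightarrow> complex \<times> real) list"

text \<open>A pair \<open>(i, t)\<close> stands for the point of component \<open>i\<close> at time \<open>t\<close>;
  \<open>params D\<close> meets every point of the link once.\<close>

definition params :: "link \<Rightarrow> (nat \<times> real) set" where
  "params D = {..<length D} \<times> {0..<1}"

definition point :: "link \<Rightarrow> nat \<times> real \<Rightarrow> complex \<times> real" where
  "point D p = (D ! fst p) (snd p)"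

definition shadow :: "link \<Rightarrow> nat \<times> real \<Rightarrow> complex" where
  "shadow D p = fst (point D p)"

definition height :: "link \<Rightarrow> nat \<times> real \<Rightarrow> real" where
  "height D p = snd (point D p)"

definition tangent :: "link \<Rightarrow> nat \<times> real \<Rightarrow> complex" where
  "tangent D p = vector_derivative (\<lambda>t. shadow D (fst p, t)) (at (snd p))"

definition shift :: "nat \<times> real \<Rightarrow> real \<Rightarrow> nat \<times> real" where
  "shift p e = (fst p, snd p + e)"

text \<open>\<open>cross v w > 0\<close> iff \<open>w\<close> points to the left of \<open>v\<close>, and \<open>cross v w = 0\<close> iff they are
  parallel.\<close>

definition cross :: "complex \<Rightarrow> complex \<Rightarrow> real" where
  "cross v w = Re v * Im w - Im v * Re w"

definition oriented_link :: "link \<Rightarrow> bool" where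
  "oriented_link D \<longleftrightarrow>
     D \<noteq> [] \<and>
     (\<forall>\<gamma>\<in>set D. \<gamma> C1_differentiable_on UNIV \<and>
        (\<forall>t. \<gamma> (t + 1) = \<gamma> t) \<and> (\<forall>t. vector_derivative \<gamma> (at t) \<noteq> 0)) \<and>
     inj_on (point D) (params D)"

text \<open>A crossing is the pair of its over-point and its under-point.\<close>

definition crossings :: "link \<Rightarrow> ((nat \<times> real) \<times> (nat \<times> real)) set" where
  "crossings D =
     {(p, q). p \<in> params D \<and> q \<in> params D \<and> shadow D p = shadow D q \<and> height D q < height D p}"

text \<open>The projection is an immersion whose only multiple points are finitely many transverse
  double points.\<close>

definition link_diagram :: "link \<Rightarrow> bool" where
  "link_diagram D \<longleftrightarrow>
     oriented_link D \<and>
     (\<forall>p\<in>params D. tangent D p \<noteq> 0) \<and>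
     finite (crossings D) \<and>
     (\<forall>(p, q)\<in>crossings D. cross (tangent D p) (tangent D q) \<noteq> 0) \<and>
     (\<forall>p\<in>params D. \<forall>q\<in>params D. \<forall>r\<in>params D.
        shadow D p = shadow D q \<and> shadow D q = shadow D r \<longrightarrow> p = q \<or> q = r \<or> p = r)"

section \<open>Arcs and colorings\<close>

text \<open>Cutting the link itself, rather than its projection, at the undercrossings leaves the
  strands connected where they pass over, so that the arcs are exactly the connected
  components of what remains.\<close>

definition arcs :: "link \<Rightarrow> (complex \<times> real) set set" where
  "arcs D = components (point D ` params D - point D ` snd ` crossings D)"

definition arc_through :: "link \<Rightarrow> nat \<times> real \<Rightarrow> (complex \<times> real) set" where
  "arc_through D p = (THE \<alpha>. \<alpha> \<in> arcs D \<and> point D p \<in> \<alpha>)"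

text \<open>The arc entered when leaving the point \<open>p\<close> forwards (\<open>\<sigma> = 1\<close>) or backwards (\<open>\<sigma> = -1\<close>).\<close>

definition arc_towards :: "link \<Rightarrow> nat \<times> real \<Rightarrow> real \<Rightarrow> (complex \<times> real) set" where
  "arc_towards D p \<sigma> =
     (THE \<alpha>. \<alpha> \<in> arcs D \<and> (\<forall>\<^sub>F e in at_right 0. point D (shift p (\<sigma> * e)) \<in> \<alpha>))"

text \<open>Leaving the crossing along \<open>\<sigma> \<cdot> tangent D q\<close> leads to the left of the over-strand iff
  \<open>\<sigma> \<cdot> cross (tangent D p) (tangent D q) > 0\<close>.\<close>

fun over_arc :: "link \<Rightarrow> (nat \<times> real) \<times> (nat \<times> real) \<Rightarrow> (complex \<times> real) set" where
  "over_arc D (p, q) = arc_through D p"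

fun left_under_arc :: "link \<Rightarrow> (nat \<times> real) \<times> (nat \<times> real) \<Rightarrow> (complex \<times> real) set" where
  "left_under_arc D (p, q) = arc_towards D q (sgn (cross (tangent D p) (tangent D q)))"

fun right_under_arc :: "link \<Rightarrow> (nat \<times> real) \<times> (nat \<times> real) \<Rightarrow> (complex \<times> real) set" where
  "right_under_arc D (p, q) = arc_towards D q (- sgn (cross (tangent D p) (tangent D q)))"

definition colorings ::
    "'q set \<Rightarrow> ('q \<Rightarrow> 'q \<Rightarrow> 'q) \<Rightarrow> link \<Rightarrow> ((complex \<times> real) set \<Rightarrow> 'q) set" where
  "colorings Q qop D =
     {C \<in> arcs D \<rightarrow>\<^sub>E Q.
        \<forall>x\<in>crossings D. C (left_under_arc D x) = qop (C (right_under_arc D x)) (C (over_arc D x))}"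

section \<open>Checkerboard coloring of the regions\<close>

definition regions :: "link \<Rightarrow> complex set set" where
  "regions D = components (- shadow D ` params D)"

text \<open>The region entered when leaving the point \<open>z\<close> of the plane in the direction \<open>w\<close>.\<close>

definition region_towards :: "link \<Rightarrow> complex \<Rightarrow> complex \<Rightarrow> complex set" where
  "region_towards D z w =
     (THE R. R \<in> regions D \<and> (\<forall>\<^sub>F e in at_right 0. z + e *\<^sub>R w \<in> R))"

text \<open>\<open>B\<close> is the set of black regions: the unbounded region is white, and the regions to the left
  and to the right of the diagram at any point other than a crossing have different colors.\<close>

definition checkerboard :: "link \<Rightarrow> complex set set \<Rightarrow> bool" where
  "checkerboard D B \<longleftrightarrow>
     B \<subseteq> regions D \<and> (\<forall>R\<in>B. bounded R) \<and>
     (\<forall>p\<in>params D. (\<forall>q\<in>params D. shadow D q = shadow D p \<longrightarrow> q = p) \<longrightarrow>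
        (region_towards D (shadow D p) (\<i> * tangent D p) \<in> B) \<noteq>
        (region_towards D (shadow D p) (- \<i> * tangent D p) \<in> B))"

text \<open>Every diagram has exactly one checkerboard coloring with white exterior, so that the choice
  below is no choice.\<close>

definition black :: "link \<Rightarrow> complex set set" where
  "black D = (SOME B. checkerboard D B)"

section \<open>Positive weights\<close>

text \<open>Rotated counterclockwise, the direction \<open>tangent D p\<close> of the over-strand first meets the
  under-strand in that one of \<open>\<plusminus>tangent D q\<close> which lies to its left. The sum of the two spans
  the interior of the sector swept; the opposite end of the over-strand sweeps the opposite sector.\<close>

fun swept_direction :: "link \<Rightarrow> (nat \<times> real) \<times> (nat \<times> real) \<Rightarrow> complex" where
  "swept_direction D (p, q) =
     tangent D p + sgn (cross (tangent D p) (tangent D q)) *\<^sub>R tangent D q"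

text \<open>Opposite sectors at a crossing have the same color, so that the second case is the one of two
  white regions.\<close>

definition pos_sign :: "link \<Rightarrow> (nat \<times> real) \<times> (nat \<times> real) \<Rightarrow> int" where
  "pos_sign D x =
     (let z = shadow D (fst x); w = swept_direction D x in
      if region_towards D z w \<in> black D \<and> region_towards D z (- w) \<in> black D then 1 else -1)"

definition pos_weight ::
    "('q \<Rightarrow> 'q \<Rightarrow> 'a::ab_group_add) \<Rightarrow> link \<Rightarrow> ((complex \<times> real) set \<Rightarrow> 'q) \<Rightarrow> 'a" where
  "pos_weight \<omega> D C =
     (\<Sum>x\<in>crossings D.
        let v = \<omega> (C (right_under_arc D x)) (C (over_arc D x))
        in if pos_sign D x = 1 then v else - v)"

section \<open>Multisets given as indexed families\<close>

text \<open>The index sets may be infinite, which the finite multisets of the library do not allow.\<close>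

definition same_multiset :: "'i set \<Rightarrow> ('i \<Rightarrow> 'a) \<Rightarrow> 'j set \<Rightarrow> ('j \<Rightarrow> 'a) \<Rightarrow> bool" where
  "same_multiset I f J g \<longleftrightarrow> (\<exists>\<phi>. bij_betw \<phi> I J \<and> (\<forall>i\<in>I. g (\<phi> i) = f i))"

end

theory Submission
  imports Defs "HOL-Complex_Analysis.Winding_Numbers"
begin

text \<open>
  Fix \<open>c\<close> in the quandle and translate colorings by \<open>a \<mapsto> a \<lhd> c\<close>; this is a bijection on colorings. With
  \<open>f a = \<omega> a c\<close> the cocycle condition reads
  \<open>\<omega> (a \<lhd> c) (b \<lhd> c) + \<omega> a b = f a + f (a \<lhd> b) - 2 f b\<close>,
  so the weights of a coloring and of its translate add up to the signed sum over the crossings of \<open>f\<close>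
  at the two under-arcs minus twice \<open>f\<close> at the over-arc. That sum vanishes: travel along each component
  and consider \<open>f\<close> of the current arc, with sign \<open>+\<close> if the region on the left is black and
  \<open>-\<close> if it is white. This step function jumps by twice the signed \<open>f\<close> at an over-point and by minus the
  signed sum of the two values of \<open>f\<close> at an under-point, and the jumps around a closed curve cancel.
  The checkerboard coloring exists because the sum of the winding numbers of the components changes
  by one across each strand: its parity is the color.
\<close>

section \<open>Local geometry\<close>

text \<open>\<open>region_towards\<close>, \<open>arc_through\<close> and \<open>arc_towards\<close>
  are definite descriptions: each is meaningful only once a short germ is known to stay in a single
  component. For curves that are merely C1 this is the main labour. It is done by pushing points of
  a strand off the diagram, uniformly along the strand up to and including a crossing. At a crossing
  the normal of one strand may be tangent to the other, so the diagonals
  \<open>\<alpha> T + \<beta> U\<close> of the two tangents replace the normals. Each diagonal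
  points into one of the four sectors, which borders a half-branch of each strand; this ties the
  colours along both strands together and makes them alternate. So the colour on the left flips at
  over- and under-points alike. At an over-point the arc stays, hence the factor 2; at an
  under-point it changes, hence the sum of two values. The cancellation holds for an arbitrary
  function on arcs; the coloring condition serves to identify \<open>a \<lhd> b\<close> as the
  colour of the left under-arc.\<close>

lemma cross_eq_Im: "cross v w = Im (cnj v * w)"
  by (simp add: cross_def)

lemma cross_simps:
  "cross v (w + w') = cross v w + cross v w'"
  "cross v (w - w') = cross v w - cross v w'"
  "cross v (- w) = - cross v w"
  "cross v (r *\<^sub>R w) = r * cross v w"
  "cross v v = 0"
  "cross v 0 = 0"
  by (simp_all add: cross_def algebra_simps)

lemma cross_swap: "cross w v = - cross v w"
  by (simp add: cross_def)

lemma abs_cross_le: "\<bar>cross v w\<bar> \<le> norm v * norm w"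
  unfolding cross_eq_Im by (metis abs_Im_le_cmod complex_mod_cnj norm_mult)

lemma cross_ii: "cross v (\<i> * v) = (norm v)\<^sup>2"
  by (simp add: cross_def cmod_def power2_eq_square)

lemma continuous_on_cross [continuous_intros]:
  assumes "continuous_on S f" "continuous_on S g"
  shows "continuous_on S (\<lambda>x. cross (f x) (g x))"
  unfolding cross_def using assms by (intro continuous_intros)

text \<open>Keeps a push \<open>e d\<close> off the strand it starts from. \<open>cross T\<close>
  kills the linear term \<open>r T\<close>, so \<open>e m\<close> is at most
  \<open>norm T * \<eta> * \<bar>r\<bar>\<close>; comparing norms bounds
  \<open>\<bar>r\<bar> * norm T\<close> by \<open>2 e M\<close>. Together they contradict
  \<open>2 * \<eta> * M < m\<close>.\<close>

lemma transverse_step_off_tangent: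
  fixes T d E :: complex
  assumes "0 < e" "m \<le> \<bar>cross T d\<bar>" "norm d \<le> M" "norm E \<le> \<eta> * \<bar>r\<bar>"
    and "2 * \<eta> \<le> norm T" "2 * \<eta> * M < m" "0 \<le> \<eta>" "T \<noteq> 0"
  shows "e *\<^sub>R d \<noteq> r *\<^sub>R T + E"
proof
  assume eq: "e *\<^sub>R d = r *\<^sub>R T + E"
  have "e * cross T d = cross T E"
    using arg_cong[OF eq, of "cross T"] by (simp add: cross_simps)
  then have "e * \<bar>cross T d\<bar> = \<bar>cross T E\<bar>"
    using assms(1) by (metis abs_mult abs_of_pos)
  also have "\<dots> \<le> norm T * (\<eta> * \<bar>r\<bar>)"
    using abs_cross_le[of T E] assms(4) by (meson mult_left_mono norm_ge_zero order_trans)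
  finally have 1: "e * m \<le> norm T * (\<eta> * \<bar>r\<bar>)"
    using assms(1,2) by (meson less_imp_le mult_left_mono order_trans)
  have "r *\<^sub>R T = e *\<^sub>R d - E" using eq by simp
  then have "norm (r *\<^sub>R T) \<le> norm (e *\<^sub>R d) + norm E"
    by (metis norm_triangle_ineq4)
  moreover have "norm (e *\<^sub>R d) \<le> e * M" using assms(1,3) by simp
  ultimately have "\<bar>r\<bar> * norm T \<le> e * M + \<eta> * \<bar>r\<bar>"
    using assms(4) by simp
  moreover have "\<bar>r\<bar> * (2 * \<eta>) \<le> \<bar>r\<bar> * norm T" using assms(5) by (simp add: mult_left_mono)
  ultimately have "\<bar>r\<bar> * norm T \<le> 2 * (e * M)" by (simp add: algebra_simps)
  then have "\<eta> * (\<bar>r\<bar> * norm T) \<le> \<eta> * (2 * (e * M))" using assms(7) mult_left_mono by blast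
  with 1 have "e * m \<le> e * (2 * \<eta> * M)" by (simp add: algebra_simps)
  then show False using assms(1,6) by simp
qed

text \<open>The analogue for a strand with tangent \<open>U\<close> crossing the first one. The step
  \<open>h\<close> along \<open>T\<close> and the push \<open>d\<close> lie on the same side
  \<open>s\<close> of \<open>U\<close>, so their contributions \<open>h c\<close> and
  \<open>e m\<close> to \<open>cross U\<close> cannot cancel, and the errors are too small to match
  them. The bound by \<open>c\<close> absorbs the terms in \<open>h\<close>, the bound by
  \<open>m\<close> those in \<open>e\<close>.\<close>

lemma sector_step_off_transversal:
  fixes T U d E1 E2 :: complex
  assumes "0 < e" "0 \<le> h" "\<bar>s\<bar> = 1" "norm d \<le> M"
    and "c \<le> s * (\<sigma> * cross U T)" "m \<le> s * cross U d"
    and "norm E1 \<le> \<eta> * \<bar>r\<bar>" "norm E2 \<le> \<eta> * h"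
    and "2 * \<eta> \<le> norm U" "2 * \<eta> * M < m" "2 * \<eta> * (norm T + \<eta>) + norm U * \<eta> \<le> c"
    and "0 \<le> \<eta>" "\<bar>\<sigma>\<bar> = 1"
  shows "r *\<^sub>R U + E1 \<noteq> (\<sigma> * h) *\<^sub>R T + E2 + e *\<^sub>R d"
proof
  assume eq: "r *\<^sub>R U + E1 = (\<sigma> * h) *\<^sub>R T + E2 + e *\<^sub>R d"
  have "cross U E1 = \<sigma> * h * cross U T + cross U E2 + e * cross U d"
    using arg_cong[OF eq, of "cross U"] by (simp add: cross_simps)
  then have "h * (s * (\<sigma> * cross U T)) + e * (s * cross U d) = s * (cross U E1 - cross U E2)"
    by (simp add: algebra_simps)
  also have "\<dots> \<le> \<bar>cross U E1\<bar> + \<bar>cross U E2\<bar>"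
  proof -
    have "s * (cross U E1 - cross U E2) \<le> \<bar>s\<bar> * \<bar>cross U E1 - cross U E2\<bar>"
      by (metis abs_ge_self abs_mult)
    then show ?thesis using assms(3) by simp
  qed
  also have "\<dots> \<le> norm U * (\<eta> * \<bar>r\<bar>) + norm U * (\<eta> * h)"
    using abs_cross_le[of U E1] abs_cross_le[of U E2] assms(7,8)
    by (meson add_mono mult_left_mono norm_ge_zero order_trans)
  finally have 1: "h * c + e * m \<le> norm U * (\<eta> * \<bar>r\<bar>) + norm U * (\<eta> * h)"
    using mult_left_mono[OF assms(5,2)] mult_left_mono[OF assms(6), of e] assms(1) by linarith
  have "r *\<^sub>R U = (\<sigma> * h) *\<^sub>R T + E2 + e *\<^sub>R d - E1" using eq by (simp add: algebra_simps)
  then have "norm (r *\<^sub>R U) \<le> norm ((\<sigma> * h) *\<^sub>R T) + norm E2 + norm (e *\<^sub>R d) + norm E1"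
    by (smt (verit) norm_triangle_ineq norm_triangle_ineq4)
  moreover have "norm (e *\<^sub>R d) \<le> e * M" using assms(1,4) by simp
  moreover have "norm ((\<sigma> * h) *\<^sub>R T) = h * norm T" using assms(2,13) by (simp add: abs_mult)
  moreover have "norm (r *\<^sub>R U) = \<bar>r\<bar> * norm U" by simp
  ultimately have "\<bar>r\<bar> * norm U \<le> h * norm T + \<eta> * h + e * M + \<eta> * \<bar>r\<bar>"
    using assms(7,8) by linarith
  moreover have "\<bar>r\<bar> * (2 * \<eta>) \<le> \<bar>r\<bar> * norm U" using assms(9) by (simp add: mult_left_mono)
  ultimately have "\<bar>r\<bar> * norm U \<le> 2 * (h * norm T + \<eta> * h + e * M)" by (simp add: algebra_simps)
  then have "\<eta> * (\<bar>r\<bar> * norm U) \<le> \<eta> * (2 * (h * norm T + \<eta> * h + e * M))"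
    using assms(12) mult_left_mono by blast
  with 1 have "h * c + e * m \<le> h * (2 * \<eta> * (norm T + \<eta>) + norm U * \<eta>) + e * (2 * \<eta> * M)"
    by (simp add: algebra_simps)
  moreover have "h * (2 * \<eta> * (norm T + \<eta>) + norm U * \<eta>) \<le> h * c"
    using assms(2,11) by (simp add: mult_left_mono)
  moreover have "e * (2 * \<eta> * M) < e * m" using assms(1,10) by simp
  ultimately show False by linarith
qed

lemma eventually_shift_not_Ints:
  assumes "\<sigma> = 1 \<or> \<sigma> = -1"
  shows "\<forall>\<^sub>F h in at_right 0. a + \<sigma> * h \<notin> (\<int> :: real set)"
  using assms
proof
  assume s: "\<sigma> = 1"
  have "\<forall>\<^sub>F h in at_right 0. h \<in> {0<..<of_int (floor a + 1) - a}"
    by (rule eventually_at_right_real) linarith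
  then show ?thesis
  proof eventually_elim
    case (elim h)
    then have "of_int (floor a) < a + \<sigma> * h" "a + \<sigma> * h < of_int (floor a + 1)"
      using s by (auto simp: algebra_simps) linarith
    then show ?case
      by (smt (verit) Ints_cases of_int_less_iff zless_imp_add1_zle)
  qed
next
  assume s: "\<sigma> = -1"
  have "\<forall>\<^sub>F h in at_right 0. h \<in> {0<..<a - of_int (ceiling a - 1)}"
    by (rule eventually_at_right_real) linarith
  then show ?thesis
  proof eventually_elim
    case (elim h)
    then have "of_int (ceiling a - 1) < a + \<sigma> * h" "a + \<sigma> * h < of_int (ceiling a)"
      using s by (auto simp: algebra_simps) linarith
    then show ?case
      by (smt (verit) Ints_cases of_int_less_iff zless_imp_add1_zle)
  qed
qed

section \<open>Link diagrams\<close>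

locale diagram =
  fixes D :: link
  assumes link_diagram: "link_diagram D"
begin

lemma C1:
  assumes "i < length D"
  obtains \<gamma>' where "\<And>t. ((D ! i) has_vector_derivative \<gamma>' t) (at t)" "continuous_on UNIV \<gamma>'"
proof -
  have "(D ! i) C1_differentiable_on UNIV"
    using link_diagram assms nth_mem unfolding link_diagram_def oriented_link_def by blast
  then show ?thesis using that unfolding C1_differentiable_on_def by blast
qed

lemma shadow_derivative:
  assumes "i < length D"
  shows "((\<lambda>t. shadow D (i, t)) has_vector_derivative tangent D (i, t)) (at t)"
    and "continuous_on UNIV (\<lambda>t. tangent D (i, t))"
    and "continuous_on UNIV (\<lambda>t. point D (i, t))"
proof -
  obtain \<gamma>' where *: "\<And>t. ((D ! i) has_vector_derivative \<gamma>' t) (at t)" "continuous_on UNIV \<gamma>'"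
    using C1[OF assms] by blast
  have d: "((\<lambda>t. shadow D (i, t)) has_vector_derivative fst (\<gamma>' t)) (at t)" for t
    unfolding shadow_def point_def using * 
    by (auto intro!: bounded_linear.has_vector_derivative[OF bounded_linear_fst])
  then have t: "tangent D (i, t) = fst (\<gamma>' t)" for t
    unfolding tangent_def by (auto intro: vector_derivative_at)
  show "((\<lambda>t. shadow D (i, t)) has_vector_derivative tangent D (i, t)) (at t)"
    using d t by simp
  show "continuous_on UNIV (\<lambda>t. tangent D (i, t))"
    unfolding t by (intro continuous_intros *)
  have "continuous_on UNIV (D ! i)"
    using *(1) by (auto intro: continuous_at_imp_continuous_on has_vector_derivative_continuous)
  then show "continuous_on UNIV (\<lambda>t. point D (i, t))"
    unfolding point_def by (simp add: eta_contract_eq)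
qed

lemma continuous_shadow: "i < length D \<Longrightarrow> continuous_on A (\<lambda>t. shadow D (i, t))"
  unfolding shadow_def
  by (intro continuous_on_fst continuous_on_subset[OF shadow_derivative(3)]) auto

lemma point_periodic_nat:
  assumes "i < length D"
  shows "point D (i, t + real n) = point D (i, t)"
proof (induction n)
  case (Suc n)
  have "(D ! i) (t + real n + 1) = (D ! i) (t + real n)"
    using link_diagram assms nth_mem unfolding link_diagram_def oriented_link_def by blast
  then show ?case using Suc by (simp add: point_def add_ac)
qed simp

lemma point_periodic:
  assumes "i < length D" "k \<in> \<int>"
  shows "point D (i, t + k) = point D (i, t)"
proof -
  obtain z :: int where k: "k = of_int z" using assms(2) Ints_cases by blast
  show ?thesis
  proof (cases "z \<ge> 0")
    case True
    then show ?thesis using k point_periodic_nat[OF assms(1), of t "nat z"] by simp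
  next
    case False
    then show ?thesis using k point_periodic_nat[OF assms(1), of "t + k" "nat (- z)"] by simp
  qed
qed

lemma shadow_periodic: "i < length D \<Longrightarrow> k \<in> \<int> \<Longrightarrow> shadow D (i, t + k) = shadow D (i, t)"
  by (simp add: shadow_def point_periodic)

lemma tangent_periodic:
  assumes "i < length D" "k \<in> \<int>"
  shows "tangent D (i, t + k) = tangent D (i, t)"
proof -
  have shift: "((\<lambda>s. s + k) has_vector_derivative 1) (at t)"
    unfolding has_real_derivative_iff_has_vector_derivative[symmetric]
    by (auto intro!: derivative_eq_intros)
  have "((\<lambda>s. shadow D (i, s + k)) has_vector_derivative tangent D (i, t + k)) (at t)"
    using vector_diff_chain_at[OF shift shadow_derivative(1)[OF assms(1), of "t + k"]]
    by (simp add: o_def)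
  then show ?thesis
    using shadow_derivative(1)[OF assms(1), of t] vector_derivative_unique_at
    by (fastforce simp: shadow_periodic[OF assms])
qed

lemma frac_shift: "frac t - t \<in> (\<int> :: real set)" "t - frac t \<in> (\<int> :: real set)"
  by (auto simp: frac_def)

lemma frac_params: "i < length D \<Longrightarrow> (i, frac t) \<in> params D"
  by (simp add: params_def frac_lt_1)

lemma at_frac:
  assumes "i < length D"
  shows "point D (i, frac t) = point D (i, t)" "shadow D (i, frac t) = shadow D (i, t)"
    "tangent D (i, frac t) = tangent D (i, t)"
  using point_periodic[OF assms frac_shift(1)[of t], of t]
    shadow_periodic[OF assms frac_shift(1)[of t], of t]
    tangent_periodic[OF assms frac_shift(1)[of t], of t] by simp_all

lemma tangent_nonzero: "i < length D \<Longrightarrow> tangent D (i, t) \<noteq> 0"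
  using link_diagram frac_params at_frac(3) unfolding link_diagram_def by metis

text \<open>Uniform in both ends \<open>x\<close> and \<open>y\<close>, unlike differentiability at
  \<open>t\<close>, because the base point \<open>t + \<sigma> * h\<close> moves too. Continuity of
  the tangent provides this through the mean value inequality.\<close>

lemma strictly_differentiable:
  assumes "i < length D" "0 < \<eta>"
  obtains \<rho> where "0 < \<rho>"
    and "\<And>x y. \<lbrakk>\<bar>x - t\<bar> < \<rho>; \<bar>y - t\<bar> < \<rho>\<rbrakk> \<Longrightarrow>
      norm (shadow D (i, y) - shadow D (i, x) - (y - x) *\<^sub>R tangent D (i, t)) \<le> \<eta> * \<bar>y - x\<bar>"
proof -
  have "continuous (at t) (\<lambda>t. tangent D (i, t))"
    using shadow_derivative(2)[OF assms(1)] by (simp add: continuous_on_eq_continuous_at)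
  then obtain \<rho> where \<rho>: "0 < \<rho>"
    "\<And>x. \<bar>x - t\<bar> < \<rho> \<Longrightarrow> norm (tangent D (i, x) - tangent D (i, t)) < \<eta>"
    using assms(2) by (auto simp: continuous_at_eps_delta dist_norm)
  have "norm (shadow D (i, y) - shadow D (i, x) - (y - x) *\<^sub>R tangent D (i, t)) \<le> norm (y - x) * \<eta>"
    if "\<bar>x - t\<bar> < \<rho>" "\<bar>y - t\<bar> < \<rho>" for x y
  proof (rule vector_differentiable_bound_linearization[where S="ball t \<rho>"])
    show "closed_segment x y \<subseteq> ball t \<rho>"
      using that by (intro closed_segment_subset) (auto simp: dist_norm)
    show "((\<lambda>t. shadow D (i, t)) has_vector_derivative tangent D (i, x)) (at x within ball t \<rho>)" for x
      using shadow_derivative(1)[OF assms(1)] has_vector_derivative_at_within by blast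
    show "norm (tangent D (i, x) - tangent D (i, t)) \<le> \<eta>" if "x \<in> ball t \<rho>" for x
      using \<rho>(2)[of x] that by (simp add: dist_norm abs_minus_commute less_imp_le)
  qed (use \<rho> in auto)
  then show ?thesis using that[OF \<rho>(1)] by (simp add: mult.commute)
qed

definition crossing_point :: "nat \<times> real \<Rightarrow> bool" where
  "crossing_point p \<longleftrightarrow> p \<in> fst ` crossings D \<union> snd ` crossings D"

text \<open>Crossings are recorded with parameters in \<open>{0..<1}\<close>, while local arguments
  move freely along the real line; \<open>frac\<close> mediates.\<close>

abbreviation simple :: "nat \<Rightarrow> real \<Rightarrow> bool" where
  "simple i t \<equiv> \<not> crossing_point (i, frac t)"

lemma finite_crossings: "finite (crossings D)"
  using link_diagram by (simp add: link_diagram_def)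

lemma crossingsD:
  assumes "(p, q) \<in> crossings D"
  shows "p \<in> params D" "q \<in> params D" "shadow D p = shadow D q" "height D q < height D p"
    "cross (tangent D p) (tangent D q) \<noteq> 0"
proof -
  show "cross (tangent D p) (tangent D q) \<noteq> 0"
    using assms link_diagram unfolding link_diagram_def by blast
qed (use assms in \<open>auto simp: crossings_def\<close>)

text \<open>The link is embedded in space, so two different points with the same shadow differ in
  height, and the height decides which one is over.\<close>

lemma crossing_of_double_point:
  assumes "p \<in> params D" "q \<in> params D" "shadow D p = shadow D q" "p \<noteq> q"
  shows "(p, q) \<in> crossings D \<or> (q, p) \<in> crossings D"
proof -
  have "point D p \<noteq> point D q"
    using assms link_diagram unfolding link_diagram_def oriented_link_def inj_on_def by blast
  then have "height D p \<noteq> height D q"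
    using assms(3) by (simp add: shadow_def height_def prod_eq_iff)
  then show ?thesis using assms by (auto simp: crossings_def)
qed

lemma no_triple_point:
  assumes "p \<in> params D" "q \<in> params D" "r \<in> params D" "shadow D p = shadow D q" "shadow D q = shadow D r"
  shows "p = q \<or> q = r \<or> p = r"
  using assms link_diagram unfolding link_diagram_def by blast

lemma same_point_cases:
  assumes "i < length D" "j < length D" "shadow D (j, u) = shadow D (i, t)"
  obtains "j = i" "u - t \<in> \<int>"
  | "((i, frac t), (j, frac u)) \<in> crossings D \<or> ((j, frac u), (i, frac t)) \<in> crossings D"
    "cross (tangent D (i, t)) (tangent D (j, u)) \<noteq> 0" "\<not> simple i t" "\<not> simple j u"
proof (cases "(i, frac t) = (j, frac u)")
  case True
  then have "u - t \<in> \<int>"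
    using Ints_diff[OF frac_shift(2)[of u] frac_shift(2)[of t]] by simp
  with True that show ?thesis by simp
next
  case False
  then have *: "((i, frac t), (j, frac u)) \<in> crossings D \<or> ((j, frac u), (i, frac t)) \<in> crossings D"
    using crossing_of_double_point[OF frac_params[OF assms(1)] frac_params[OF assms(2)]] assms at_frac
    by metis
  then have "cross (tangent D (i, t)) (tangent D (j, u)) \<noteq> 0"
    using crossingsD(5) at_frac(3) assms cross_swap by (metis neg_equal_0_iff_equal)
  moreover have "\<not> simple i t" "\<not> simple j u"
    using * unfolding crossing_point_def by force+
  ultimately show ?thesis using that * by blast
qed

text \<open>There are finitely many crossing parameters, and small shifts miss each of them modulo
  1; \<open>t\<close> itself may be one of them.\<close>

lemma eventually_simple:
  assumes "\<sigma> = 1 \<or> \<sigma> = -1"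
  shows "\<forall>\<^sub>F h in at_right 0. simple i (t + \<sigma> * h)"
proof -
  have "\<forall>\<^sub>F h in at_right 0. \<forall>p\<in>fst ` crossings D \<union> snd ` crossings D. (t - snd p) + \<sigma> * h \<notin> \<int>"
    using finite_crossings by (intro eventually_ball_finite ballI eventually_shift_not_Ints assms) auto
  then show ?thesis
  proof eventually_elim
    case (elim h)
    have "t + \<sigma> * h - frac (t + \<sigma> * h) \<in> \<int>" by (rule frac_shift)
    moreover have "t + \<sigma> * h - snd p \<notin> \<int>" if "crossing_point p" for p
      using elim that unfolding crossing_point_def by (simp add: algebra_simps)
    ultimately show ?case by fastforce
  qed
qed

end

section \<open>Compactness arguments, and components entered by a germ\<close>

lemma compact_positive_lower_bound:
  fixes f :: "'a::topological_space \<Rightarrow> real"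
  assumes "compact S" "continuous_on S f" "\<And>x. x \<in> S \<Longrightarrow> 0 < f x"
  obtains m where "0 < m" "\<And>x. x \<in> S \<Longrightarrow> m \<le> f x"
proof (cases "S = {}")
  case True
  then show ?thesis using that[of 1] by simp
next
  case False
  then obtain x where "x \<in> S" "\<And>y. y \<in> S \<Longrightarrow> f x \<le> f y"
    using continuous_attains_inf[OF assms(1) _ assms(2)] by blast
  then show ?thesis using that[of "f x"] assms(3) by simp
qed

text \<open>A Lebesgue number argument in which \<rho> is both the radius of validity and the
  parameter of \<open>P\<close>. As \<open>P\<close> survives shrinking \<rho>, the minimum over a
  finite subcover serves everywhere.\<close>

lemma compact_eventually_uniform:
  fixes S :: "'a::metric_space set"
  assumes "compact S"
    and "\<And>x. x \<in> S \<Longrightarrow> \<exists>\<rho>>0. \<forall>y. dist x y < \<rho> \<longrightarrow> P \<rho> y"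
    and "\<And>\<rho> \<rho>' y. P \<rho> y \<Longrightarrow> \<rho>' \<le> \<rho> \<Longrightarrow> P \<rho>' y"
  shows "\<exists>\<rho>>(0::real). \<forall>y\<in>S. P \<rho> y"
proof -
  obtain \<rho> where \<rho>: "\<And>x. x \<in> S \<Longrightarrow> 0 < \<rho> x \<and> (\<forall>y. dist x y < \<rho> x \<longrightarrow> P (\<rho> x) y)"
    using assms(2) by metis
  have "S \<subseteq> (\<Union>x\<in>S. ball x (\<rho> x))" using \<rho> by force
  then obtain F where F: "F \<subseteq> S" "finite F" "S \<subseteq> (\<Union>x\<in>F. ball x (\<rho> x))"
    using compactE_image[OF assms(1), of S "\<lambda>x. ball x (\<rho> x)"] by auto
  define \<delta> where "\<delta> = Min (insert 1 (\<rho> ` F))"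
  have le: "\<delta> \<le> \<rho> x" if "x \<in> F" for x
    unfolding \<delta>_def using F(2) that by (intro Min_le) auto
  have "0 < \<delta>"
    unfolding \<delta>_def using F \<rho> by (subst Min_gr_iff) auto
  moreover have "P \<delta> y" if y: "y \<in> S" for y
  proof -
    obtain x where "x \<in> F" "dist x y < \<rho> x" using F(3) y by auto
    then show ?thesis using \<rho> F(1) le assms(3) by blast
  qed
  ultimately show ?thesis by blast
qed

text \<open>Gives meaning to the descriptions of regions and of arcs. Two components that a germ
  eventually enters share a point, as \<open>at_right 0\<close> is not trivial, and hence are equal;
  \<open>X\<close> is a connected witness that one is entered.\<close>

lemma the_component_entered:
  fixes f :: "real \<Rightarrow> 'a::topological_space"
  assumes "connected X" "X \<subseteq> S" "x \<in> X" "\<forall>\<^sub>F e in at_right 0. f e \<in> X"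
  shows "(THE R. R \<in> components S \<and> (\<forall>\<^sub>F e in at_right 0. f e \<in> R)) = connected_component_set S x"
    "connected_component_set S x \<in> components S"
    "\<forall>\<^sub>F e in at_right 0. f e \<in> connected_component_set S x"
proof -
  let ?C = "connected_component_set S x"
  have "X \<subseteq> ?C"
    using assms by (intro connected_component_maximal) auto
  then show ev: "\<forall>\<^sub>F e in at_right 0. f e \<in> ?C"
    using assms(4) by (auto elim: eventually_mono)
  show C: "?C \<in> components S"
    unfolding components_def using assms by auto
  show "(THE R. R \<in> components S \<and> (\<forall>\<^sub>F e in at_right 0. f e \<in> R)) = ?C"
  proof (rule the_equality)
    fix R assume R: "R \<in> components S \<and> (\<forall>\<^sub>F e in at_right 0. f e \<in> R)"
    have "\<forall>\<^sub>F e in at_right 0. f e \<in> R \<inter> ?C"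
      using R ev by (auto elim: eventually_elim2)
    then have "R \<inter> ?C \<noteq> {}"
      using eventually_happens'[OF trivial_limit_at_right_real] by blast
    then show "R = ?C"
      using R C components_eq by blast
  qed (use ev C in auto)
qed

section \<open>Pushing points of a strand off the diagram\<close>

context diagram
begin

definition curve :: "complex set" where
  "curve = shadow D ` params D"

text \<open>Closed parameter intervals are compact, unlike the half-open ones of
  \<open>params\<close>; periodicity accounts for the extra endpoint.\<close>

lemma curve_eq: "curve = (\<Union>i<length D. (\<lambda>t. shadow D (i, t)) ` {0..1})"
proof -
  have "shadow D (i, t) \<in> curve" if "i < length D" for i t
    using frac_params[OF that, of t] at_frac(2)[OF that, of t] unfolding curve_def by (metis imageI)
  then show ?thesis unfolding curve_def params_def by fastforce
qed

lemma shadow_in_curve: "i < length D \<Longrightarrow> shadow D (i, t) \<in> curve"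
  using frac_params[of i t] at_frac(2)[of i t] unfolding curve_def by (metis imageI)

text \<open>The directions in which the half-branch leaving the point \<open>t\<close> of component \<open>i\<close> forwards
  (\<open>\<sigma> = 1\<close>) or backwards (\<open>\<sigma> = -1\<close>) can be pushed off the diagram without meeting another strand
  through that point: the half-branch and the direction lie on the same side of such a strand.\<close>

definition sector :: "nat \<Rightarrow> real \<Rightarrow> real \<Rightarrow> complex set" where
  "sector i t \<sigma> = {d. cross (tangent D (i, t)) d \<noteq> 0 \<and>
     (\<forall>j<length D. \<forall>u. shadow D (j, u) = shadow D (i, t) \<longrightarrow>
        cross (tangent D (i, t)) (tangent D (j, u)) \<noteq> 0 \<longrightarrow>
        0 < (\<sigma> * cross (tangent D (j, u)) (tangent D (i, t))) * cross (tangent D (j, u)) d)}"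

lemma locally_off_curve:
  assumes i: "i < length D" and j: "j < length D" and \<sigma>: "\<sigma> = 1 \<or> \<sigma> = -1"
    and S: "compact S" "S \<subseteq> sector i t \<sigma>"
  shows "\<exists>\<rho>>0. \<forall>u. dist u0 u < \<rho> \<longrightarrow> (\<forall>h e d. 0 \<le> h \<and> h < \<rho> \<and> 0 < e \<and> e < \<rho> \<and> d \<in> S \<longrightarrow>
           shadow D (j, u) \<noteq> shadow D (i, t + \<sigma> * h) + e *\<^sub>R d)"
proof -
  define T where "T = tangent D (i, t)"
  define U where "U = tangent D (j, u0)"
  have TU: "T \<noteq> 0" "U \<noteq> 0" unfolding T_def U_def using tangent_nonzero i j by auto
  obtain M where M: "0 < M" "\<And>d. d \<in> S \<Longrightarrow> norm d \<le> M"
    using compact_imp_bounded[OF S(1)] by (auto simp: bounded_pos)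
  show ?thesis
  proof (cases "shadow D (j, u0) = shadow D (i, t)")
    case False
    \<comment> \<open>A third, since three displacements share the distance: moving
      \<open>u\<close>, moving along strand \<open>i\<close>, and the push
      \<open>e d\<close>.\<close>
    define r where "r = dist (shadow D (j, u0)) (shadow D (i, t)) / 3"
    have r: "0 < r" using False unfolding r_def by simp
    have "continuous (at u0) (\<lambda>u. shadow D (j, u))" "continuous (at t) (\<lambda>u. shadow D (i, u))"
      using continuous_shadow[of _ UNIV] i j by (auto simp: continuous_on_eq_continuous_at)
    then obtain \<rho>1 \<rho>2 where \<rho>: "0 < \<rho>1" "\<And>u. \<bar>u - u0\<bar> < \<rho>1 \<Longrightarrow> dist (shadow D (j, u)) (shadow D (j, u0)) < r"
      "0 < \<rho>2" "\<And>u. \<bar>u - t\<bar> < \<rho>2 \<Longrightarrow> dist (shadow D (i, u)) (shadow D (i, t)) < r"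
      using r unfolding continuous_at_eps_delta dist_real_def by metis
    define \<rho> where "\<rho> = min (min \<rho>1 \<rho>2) (r / M)"
    show ?thesis
    proof (intro exI[of _ \<rho>] conjI allI impI, goal_cases)
      case 1
      show ?case unfolding \<rho>_def using \<rho> r M by simp
    next
      case (2 u h e d)
      have a: "dist (shadow D (j, u)) (shadow D (j, u0)) < r"
        using 2 by (intro \<rho>(2)) (auto simp: \<rho>_def dist_real_def)
      have b: "dist (shadow D (i, t + \<sigma> * h)) (shadow D (i, t)) < r"
        using 2 \<sigma> by (intro \<rho>(4)) (auto simp: \<rho>_def)
      have "e * norm d \<le> e * M" using 2 M(2)[of d] by simp
      also have "\<dots> < (r / M) * M" using 2 M(1) unfolding \<rho>_def by (intro mult_strict_right_mono) auto
      finally have "e * norm d < (r / M) * M" .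
      then have "dist (shadow D (i, t + \<sigma> * h) + e *\<^sub>R d) (shadow D (i, t + \<sigma> * h)) < r"
        using 2 M by (simp add: dist_norm)
      then have "3 * r \<noteq> dist (shadow D (j, u0)) (shadow D (i, t))"
        if "shadow D (j, u) = shadow D (i, t + \<sigma> * h) + e *\<^sub>R d"
        using a b dist_triangle[of "shadow D (j, u0)" "shadow D (i, t)" "shadow D (j, u)"]
          dist_triangle[of "shadow D (j, u)" "shadow D (i, t)" "shadow D (i, t + \<sigma> * h)"]
        unfolding that by (simp add: dist_commute)
      then show ?case unfolding r_def by auto
    qed
  next
    case True
    note same = this
    from same_point_cases[OF i j True] show ?thesis
    proof cases
      case 1
      have "continuous_on S (\<lambda>d. \<bar>cross T d\<bar>)" by (intro continuous_intros)
      moreover have "0 < \<bar>cross T d\<bar>" if "d \<in> S" for d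
        using S(2) that unfolding sector_def T_def by auto
      ultimately obtain m where m: "0 < m" "\<And>d. d \<in> S \<Longrightarrow> m \<le> \<bar>cross T d\<bar>"
        using compact_positive_lower_bound[OF S(1)] by blast
      have lim: "((\<lambda>\<eta>. 2 * \<eta>) \<longlongrightarrow> 0) (at_right (0::real))" "((\<lambda>\<eta>. 2 * \<eta> * M) \<longlongrightarrow> 0) (at_right 0)"
        by (auto intro!: tendsto_eq_intros)
      then have "\<forall>\<^sub>F \<eta> in at_right 0. 0 < \<eta> \<and> 2 * \<eta> < norm T \<and> 2 * \<eta> * M < m"
        using m TU by (intro eventually_conj eventually_at_right_less lim[THEN order_tendstoD(2)]) auto
      then obtain \<eta> where \<eta>: "0 < \<eta>" "2 * \<eta> < norm T" "2 * \<eta> * M < m"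
        using eventually_happens'[OF trivial_limit_at_right_real] by blast
      obtain \<rho> where \<rho>: "0 < \<rho>" "\<And>x y. \<lbrakk>\<bar>x - t\<bar> < \<rho>; \<bar>y - t\<bar> < \<rho>\<rbrakk> \<Longrightarrow>
          norm (shadow D (i, y) - shadow D (i, x) - (y - x) *\<^sub>R T) \<le> \<eta> * \<bar>y - x\<bar>"
        using strictly_differentiable[OF i \<eta>(1)] unfolding T_def by metis
      show ?thesis
      proof (intro exI[of _ \<rho>] conjI allI impI, goal_cases)
        case 1 show ?case by (rule \<rho>)
      next
        case (2 u h e d)
        \<comment> \<open>\<open>u0 - t\<close> is an integer; translating by it moves
          \<open>u\<close> near \<open>t\<close>, where the linear estimate is available.\<close>
        define u' where "u' = u - (u0 - t)"
        have eq: "shadow D (j, u) = shadow D (i, u')"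
          using shadow_periodic[OF i 1(2), of u'] 1(1) unfolding u'_def by simp
        define E where "E = shadow D (i, u') - shadow D (i, t + \<sigma> * h) - (u' - (t + \<sigma> * h)) *\<^sub>R T"
        have "norm E \<le> \<eta> * \<bar>u' - (t + \<sigma> * h)\<bar>"
          unfolding E_def using 2 \<sigma> by (intro \<rho>(2)) (auto simp: u'_def dist_real_def)
        then have "e *\<^sub>R d \<noteq> (u' - (t + \<sigma> * h)) *\<^sub>R T + E" (is "_ \<noteq> ?R")
          using 2 m M \<eta> TU by (intro transverse_step_off_tangent[where m=m and M=M and \<eta>=\<eta>]) auto
        moreover have "?R = shadow D (j, u) - shadow D (i, t + \<sigma> * h)" unfolding E_def eq by simp
        ultimately show ?case by auto
      qed
    next
      case 2
      \<comment> \<open>The side of the crossing strand on which the half-branch lies;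
        \<open>sector\<close> puts every push on that side too.\<close>
      define s where "s = sgn (\<sigma> * cross U T)"
      have UT: "cross U T \<noteq> 0"
        using 2(2) cross_swap unfolding U_def T_def by (metis neg_equal_0_iff_equal)
      then have s: "\<bar>s\<bar> = 1" using \<sigma> unfolding s_def by (auto simp: sgn_real_def)
      define c where "c = s * (\<sigma> * cross U T)"
      have c: "0 < c" unfolding c_def s_def using UT \<sigma> by (auto simp: sgn_real_def zero_less_mult_iff)
      have "continuous_on S (\<lambda>d. s * cross U d)" by (intro continuous_intros)
      moreover have "0 < s * cross U d" if d: "d \<in> S" for d
      proof -
        have "0 < (\<sigma> * cross U T) * cross U d"
          using S(2) d 2(2) same j unfolding sector_def T_def U_def by blast
        moreover have "0 < a * b \<Longrightarrow> 0 < sgn a * b" for a b :: real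
          by (auto simp: sgn_if zero_less_mult_iff)
        ultimately show ?thesis unfolding s_def by blast
      qed
      ultimately obtain m where m: "0 < m" "\<And>d. d \<in> S \<Longrightarrow> m \<le> s * cross U d"
        using compact_positive_lower_bound[OF S(1)] by blast
      have lim: "((\<lambda>\<eta>. 2 * \<eta>) \<longlongrightarrow> 0) (at_right (0::real))" "((\<lambda>\<eta>. 2 * \<eta> * M) \<longlongrightarrow> 0) (at_right 0)"
        "((\<lambda>\<eta>. 2 * \<eta> * (norm T + \<eta>) + norm U * \<eta>) \<longlongrightarrow> 0) (at_right 0)"
        by (auto intro!: tendsto_eq_intros)
      then have "\<forall>\<^sub>F \<eta> in at_right 0. 0 < \<eta> \<and> 2 * \<eta> < norm U \<and> 2 * \<eta> * M < m
          \<and> 2 * \<eta> * (norm T + \<eta>) + norm U * \<eta> < c"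
        using m TU c by (intro eventually_conj eventually_at_right_less lim[THEN order_tendstoD(2)]) auto
      then obtain \<eta> where \<eta>: "0 < \<eta>" "2 * \<eta> < norm U" "2 * \<eta> * M < m"
          "2 * \<eta> * (norm T + \<eta>) + norm U * \<eta> < c"
        using eventually_happens'[OF trivial_limit_at_right_real] by blast
      obtain \<rho>1 where \<rho>1: "0 < \<rho>1" "\<And>x y. \<lbrakk>\<bar>x - t\<bar> < \<rho>1; \<bar>y - t\<bar> < \<rho>1\<rbrakk> \<Longrightarrow>
          norm (shadow D (i, y) - shadow D (i, x) - (y - x) *\<^sub>R T) \<le> \<eta> * \<bar>y - x\<bar>"
        using strictly_differentiable[OF i \<eta>(1)] unfolding T_def by metis
      obtain \<rho>2 where \<rho>2: "0 < \<rho>2" "\<And>x y. \<lbrakk>\<bar>x - u0\<bar> < \<rho>2; \<bar>y - u0\<bar> < \<rho>2\<rbrakk> \<Longrightarrow>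
          norm (shadow D (j, y) - shadow D (j, x) - (y - x) *\<^sub>R U) \<le> \<eta> * \<bar>y - x\<bar>"
        using strictly_differentiable[OF j \<eta>(1)] unfolding U_def by metis
      show ?thesis
      proof (intro exI[of _ "min \<rho>1 \<rho>2"] conjI allI impI, goal_cases)
        case 1 show ?case using \<rho>1 \<rho>2 by simp
      next
        case (2 u h e d)
        define E1 where "E1 = shadow D (j, u) - shadow D (j, u0) - (u - u0) *\<^sub>R U"
        define E2 where "E2 = shadow D (i, t + \<sigma> * h) - shadow D (i, t) - (\<sigma> * h) *\<^sub>R T"
        have "norm E1 \<le> \<eta> * \<bar>u - u0\<bar>"
          unfolding E1_def using 2 \<rho>2(1) by (intro \<rho>2(2)) (auto simp: dist_real_def)
        moreover have "norm (shadow D (i, t + \<sigma> * h) - shadow D (i, t) - (t + \<sigma> * h - t) *\<^sub>R T) \<le> \<eta> * \<bar>t + \<sigma> * h - t\<bar>"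
          using 2 \<rho>1(1) \<sigma> by (intro \<rho>1(2)) auto
        then have "norm E2 \<le> \<eta> * h"
          unfolding E2_def using 2 \<sigma> by auto
        ultimately have "(u - u0) *\<^sub>R U + E1 \<noteq> (\<sigma> * h) *\<^sub>R T + E2 + e *\<^sub>R d"
          using 2 m M \<eta> \<sigma> s
          by (intro sector_step_off_transversal[where m=m and M=M and \<eta>=\<eta> and s=s and c=c])
             (auto simp: c_def)
        then show ?case unfolding E1_def E2_def using same by (simp add: algebra_simps)
      qed
    qed
  qed
qed

text \<open>The local bounds become uniform by compactness of \<open>{0..1}\<close> on each
  component and a minimum over the finitely many components.\<close>

lemma off_curve:
  assumes i: "i < length D" and \<sigma>: "\<sigma> = 1 \<or> \<sigma> = -1"
    and S: "compact S" "S \<subseteq> sector i t \<sigma>"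
  obtains \<delta> where "0 < \<delta>"
    "\<And>h e d. \<lbrakk>0 \<le> h; h < \<delta>; 0 < e; e < \<delta>; d \<in> S\<rbrakk> \<Longrightarrow> shadow D (i, t + \<sigma> * h) + e *\<^sub>R d \<notin> curve"
proof -
  let ?P = "\<lambda>j \<rho> u. \<forall>h e d. 0 \<le> h \<and> h < \<rho> \<and> 0 < e \<and> e < \<rho> \<and> d \<in> S \<longrightarrow>
           shadow D (j, u) \<noteq> shadow D (i, t + \<sigma> * h) + e *\<^sub>R d"
  have "\<exists>\<rho>>0. \<forall>u\<in>{0..1}. ?P j \<rho> u" if "j < length D" for j
    by (rule compact_eventually_uniform[where P="?P j"])
       (use locally_off_curve[OF i that \<sigma> S] in auto)
  then obtain \<rho> where \<rho>: "\<And>j. j < length D \<Longrightarrow> 0 < \<rho> j \<and> (\<forall>u\<in>{0..1}. ?P j (\<rho> j) u)"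
    by metis
  define \<delta> where "\<delta> = Min (insert 1 (\<rho> ` {..<length D}))"
  have "0 < \<delta>" unfolding \<delta>_def using \<rho> by (subst Min_gr_iff) auto
  moreover have le: "\<delta> \<le> \<rho> j" if "j < length D" for j
    unfolding \<delta>_def using that by (intro Min_le) auto
  have "shadow D (i, t + \<sigma> * h) + e *\<^sub>R d \<notin> curve"
    if *: "0 \<le> h" "h < \<delta>" "0 < e" "e < \<delta>" "d \<in> S" for h e d
  proof
    assume "shadow D (i, t + \<sigma> * h) + e *\<^sub>R d \<in> curve"
    then obtain j u where "j < length D" "u \<in> {0..1}" "shadow D (j, u) = shadow D (i, t + \<sigma> * h) + e *\<^sub>R d"
      unfolding curve_eq by auto
    then show False using \<rho>[of j] le[of j] * by force
  qed
  ultimately show ?thesis using that by blast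
qed

section \<open>Regions adjacent to a strand\<close>

lemma region_towards_eq:
  assumes "connected X" "X \<inter> curve = {}" "x \<in> X" "\<forall>\<^sub>F e in at_right 0. z + e *\<^sub>R w \<in> X"
  shows "region_towards D z w = connected_component_set (- curve) x"
    "\<forall>\<^sub>F e in at_right 0. z + e *\<^sub>R w \<in> region_towards D z w"
    "region_towards D z w \<in> regions D"
proof -
  have "X \<subseteq> - curve" using assms(2) by blast
  note * = the_component_entered[OF assms(1) this assms(3,4)]
  show eq: "region_towards D z w = connected_component_set (- curve) x"
    unfolding region_towards_def regions_def curve_def[symmetric] by (rule *)
  show "\<forall>\<^sub>F e in at_right 0. z + e *\<^sub>R w \<in> region_towards D z w" unfolding eq by (rule *)
  show "region_towards D z w \<in> regions D"
    unfolding eq unfolding regions_def curve_def[symmetric] by (rule *)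
qed

lemma eventually_at_right_0_less: "0 < (\<delta>::real) \<Longrightarrow> \<forall>\<^sub>F e in at_right 0. 0 < e \<and> e < \<delta>"
  using eventually_at_right_real by (auto elim!: eventually_mono)

text \<open>The rectangle of pushes from base points with \<open>h < \<delta>\<close> has a
  connected image off the diagram. The germs in direction \<open>d\<close> at all these base points,
  \<open>h = 0\<close> included, start inside it.\<close>

lemma region_along_curve:
  assumes i: "i < length D" and \<sigma>: "\<sigma> = 1 \<or> \<sigma> = -1" and d: "d \<in> sector i t \<sigma>"
  shows "\<forall>\<^sub>F h in at_right 0.
    region_towards D (shadow D (i, t + \<sigma> * h)) d = region_towards D (shadow D (i, t)) d"
proof -
  obtain \<delta> where \<delta>': "0 < \<delta>" "\<And>h e x. \<lbrakk>0 \<le> h; h < \<delta>; 0 < e; e < \<delta>; x \<in> {d}\<rbrakk> \<Longrightarrow>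
      shadow D (i, t + \<sigma> * h) + e *\<^sub>R x \<notin> curve"
    by (rule off_curve[OF i \<sigma>, of "{d}" t]) (use d in auto)
  note \<delta> = \<delta>'(1) \<delta>'(2)[OF _ _ _ _ singletonI]
  define X where "X = (\<lambda>(h, e). shadow D (i, t + \<sigma> * h) + e *\<^sub>R d) ` ({0..<\<delta>} \<times> {0<..<\<delta>})"
  have "continuous_on UNIV (\<lambda>p::real \<times> real. shadow D (i, t + \<sigma> * fst p))"
    by (rule continuous_on_compose2[OF continuous_shadow[OF i, of UNIV]])
       (auto intro!: continuous_intros)
  then have c: "continuous_on A (\<lambda>p::real \<times> real. shadow D (i, t + \<sigma> * fst p))" for A
    using continuous_on_subset by blast
  have "connected X"
    unfolding X_def case_prod_unfold
    by (intro connected_continuous_image convex_connected convex_Times continuous_intros c) auto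
  moreover have "X \<inter> curve = {}" unfolding X_def using \<delta> by auto
  moreover have inX: "shadow D (i, t + \<sigma> * h) + e *\<^sub>R d \<in> X" if "0 \<le> h" "h < \<delta>" "0 < e" "e < \<delta>" for h e
    unfolding X_def using that by force
  moreover from this have "\<forall>\<^sub>F e in at_right 0. shadow D (i, t + \<sigma> * h) + e *\<^sub>R d \<in> X"
    if "0 \<le> h" "h < \<delta>" for h
    using that eventually_at_right_0_less[OF \<delta>(1)] by (auto elim!: eventually_mono)
  moreover have "shadow D (i, t) + (\<delta> / 2) *\<^sub>R d \<in> X" using inX[of 0 "\<delta> / 2"] \<delta>(1) by simp
  ultimately have eq: "region_towards D (shadow D (i, t + \<sigma> * h)) d =
      connected_component_set (- curve) (shadow D (i, t) + (\<delta> / 2) *\<^sub>R d)"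
    if "0 \<le> h" "h < \<delta>" for h
    using that by (intro region_towards_eq(1)[of X]) auto
  show ?thesis
    using eventually_at_right_0_less[OF \<delta>(1)]
  proof eventually_elim
    case (elim h)
    then show ?case using eq[of h] eq[of 0] \<delta>(1) by simp
  qed
qed

lemma simpleD:
  assumes "i < length D" "simple i t" "j < length D" "shadow D (j, u) = shadow D (i, t)"
  shows "j = i" "u - t \<in> \<int>"
  using same_point_cases[OF assms(1,3,4)] assms(2) by blast+

lemma sector_simple:
  assumes "i < length D" "simple i t"
  shows "sector i t \<sigma> = {d. cross (tangent D (i, t)) d \<noteq> 0}"
proof -
  have "cross (tangent D (i, t)) (tangent D (j, u)) = 0"
    if "j < length D" "shadow D (j, u) = shadow D (i, t)" for j u
    using simpleD[OF assms that] tangent_periodic[of i "u - t" t] assms(1) by (simp add: cross_simps)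
  then show ?thesis unfolding sector_def by auto
qed

text \<open>Directions on one side of the tangent form a convex set, so the segment from
  \<open>d\<close> to \<open>d'\<close> sweeps out a connected truncated cone off the diagram that
  contains both germs. With \<open>d' = d\<close> this also shows that the region exists.\<close>

lemma region_same_side:
  assumes i: "i < length D" "simple i t"
    and dd: "0 < cross (tangent D (i, t)) d * cross (tangent D (i, t)) d'"
  shows "region_towards D (shadow D (i, t)) d = region_towards D (shadow D (i, t)) d'"
    "\<forall>\<^sub>F e in at_right 0. shadow D (i, t) + e *\<^sub>R d \<in> region_towards D (shadow D (i, t)) d"
    "region_towards D (shadow D (i, t)) d \<in> regions D"
proof -
  let ?S = "closed_segment d d'" and ?T = "tangent D (i, t)"
  have "cross ?T x \<noteq> 0" if seg: "x \<in> ?S" for x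
  proof -
    obtain u where u: "0 \<le> u" "u \<le> 1" "x = (1 - u) *\<^sub>R d + u *\<^sub>R d'"
      using seg unfolding in_segment by blast
    have x: "cross ?T x = (1 - u) * cross ?T d + u * cross ?T d'"
      unfolding u(3) by (simp only: cross_simps)
    \<comment> \<open>Multiplying by \<open>cross ?T d\<close> spares a case split on its sign: the
      product with \<open>cross ?T x\<close> is a convex combination of positive numbers.\<close>
    have "0 < (1 - u) * (cross ?T d)\<^sup>2 + u * (cross ?T d * cross ?T d')"
    proof (cases "u = 0")
      case False
      then show ?thesis using u(1,2) dd by (intro add_nonneg_pos mult_pos_pos[of u] mult_nonneg_nonneg) auto
    qed (use dd in auto)
    also have "\<dots> = cross ?T d * cross ?T x"
      unfolding x by (simp add: algebra_simps power2_eq_square)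
    finally show ?thesis by auto
  qed
  then have "?S \<subseteq> sector i t 1" using sector_simple[OF i] by auto
  then obtain \<delta> where \<delta>: "0 < \<delta>"
    "\<And>h e d. \<lbrakk>0 \<le> h; h < \<delta>; 0 < e; e < \<delta>; d \<in> ?S\<rbrakk> \<Longrightarrow> shadow D (i, t + 1 * h) + e *\<^sub>R d \<notin> curve"
    using off_curve[OF i(1), of 1 ?S t] by auto
  define X where "X = (\<lambda>(e, d). shadow D (i, t) + e *\<^sub>R d) ` ({0<..<\<delta>} \<times> ?S)"
  have "connected X"
    unfolding X_def case_prod_unfold
    by (intro connected_continuous_image convex_connected convex_Times continuous_intros) auto
  moreover have "X \<inter> curve = {}" unfolding X_def using \<delta>(2)[of 0] \<delta>(1) by auto
  moreover have "shadow D (i, t) + e *\<^sub>R x \<in> X" if "0 < e" "e < \<delta>" "x \<in> ?S" for e x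
    unfolding X_def using that by force
  moreover from this have "\<forall>\<^sub>F e in at_right 0. shadow D (i, t) + e *\<^sub>R x \<in> X" if "x \<in> ?S" for x
    using that eventually_at_right_0_less[OF \<delta>(1)] by (auto elim!: eventually_mono)
  ultimately have *: "connected X" "X \<inter> curve = {}" "shadow D (i, t) + (\<delta> / 2) *\<^sub>R d \<in> X"
      "\<And>x. x \<in> ?S \<Longrightarrow> \<forall>\<^sub>F e in at_right 0. shadow D (i, t) + e *\<^sub>R x \<in> X"
    using \<delta>(1) by auto
  show "region_towards D (shadow D (i, t)) d = region_towards D (shadow D (i, t)) d'"
    using region_towards_eq(1)[OF *(1-3) *(4)[of d]] region_towards_eq(1)[OF *(1-3) *(4)[of d']] by simp
  show "\<forall>\<^sub>F e in at_right 0. shadow D (i, t) + e *\<^sub>R d \<in> region_towards D (shadow D (i, t)) d"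
    "region_towards D (shadow D (i, t)) d \<in> regions D"
    using region_towards_eq(2,3)[OF *(1-3) *(4)[of d]] by simp_all
qed

text \<open>Reliable away from crossings: at a crossing the normal may be tangent to the other
  strand. Crossings are therefore approached through one-sided limits.\<close>

definition left_region :: "nat \<Rightarrow> real \<Rightarrow> complex set" where
  "left_region i t = region_towards D (shadow D (i, t)) (\<i> * tangent D (i, t))"

definition right_region :: "nat \<Rightarrow> real \<Rightarrow> complex set" where
  "right_region i t = region_towards D (shadow D (i, t)) (- \<i> * tangent D (i, t))"

text \<open>The tangent turns along the strand while \<open>d\<close> is fixed. By continuity
  \<open>d\<close> stays on its side of the tangent for small \<open>h\<close>, and at a simple
  point it may be exchanged for the normal.\<close>

lemma side_region_along_curve:
  assumes i: "i < length D" and \<sigma>: "\<sigma> = 1 \<or> \<sigma> = -1" and d: "d \<in> sector i t \<sigma>"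
  shows "0 < cross (tangent D (i, t)) d \<Longrightarrow>
      \<forall>\<^sub>F h in at_right 0. left_region i (t + \<sigma> * h) = region_towards D (shadow D (i, t)) d"
    and "cross (tangent D (i, t)) d < 0 \<Longrightarrow>
      \<forall>\<^sub>F h in at_right 0. right_region i (t + \<sigma> * h) = region_towards D (shadow D (i, t)) d"
proof -
  have "continuous_on UNIV (\<lambda>h. tangent D (i, t + \<sigma> * h))"
    by (rule continuous_on_compose2[OF shadow_derivative(2)[OF i]]) (auto intro!: continuous_intros)
  then have "continuous_on UNIV (\<lambda>h. cross (tangent D (i, t + \<sigma> * h)) d)"
    by (intro continuous_intros)
  then have "isCont (\<lambda>h. cross (tangent D (i, t + \<sigma> * h)) d) 0"
    by (simp add: continuous_on_eq_continuous_at)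
  then have lim: "((\<lambda>h. cross (tangent D (i, t + \<sigma> * h)) d) \<longlongrightarrow> cross (tangent D (i, t)) d) (at_right 0)"
    by (simp add: isCont_def filterlim_at_split)
  have pos: "0 < cross T (\<i> * T)" if "T \<noteq> 0" for T using that by (simp add: cross_ii)
  have T: "tangent D (i, t + \<sigma> * h) \<noteq> 0" for h by (rule tangent_nonzero[OF i])
  note ev = region_along_curve[OF i \<sigma> d] eventually_simple[OF \<sigma>, of i t]
  show "\<forall>\<^sub>F h in at_right 0. left_region i (t + \<sigma> * h) = region_towards D (shadow D (i, t)) d"
    if "0 < cross (tangent D (i, t)) d"
    using ev order_tendstoD(1)[OF lim that]
  proof eventually_elim
    case (elim h)
    then show ?case
      unfolding left_region_def
      using region_same_side(1)[OF i elim(2), of "\<i> * tangent D (i, t + \<sigma> * h)" d] pos[OF T] by simp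
  qed
  show "\<forall>\<^sub>F h in at_right 0. right_region i (t + \<sigma> * h) = region_towards D (shadow D (i, t)) d"
    if "cross (tangent D (i, t)) d < 0"
    using ev order_tendstoD(2)[OF lim that]
  proof eventually_elim
    case (elim h)
    then show ?case
      unfolding right_region_def
      using region_same_side(1)[OF i elim(2), of "- \<i> * tangent D (i, t + \<sigma> * h)" d] pos[OF T, of h]
      by (simp add: cross_simps mult_pos_neg)
  qed
qed

end

section \<open>Jumps of periodic step functions\<close>

text \<open>\<open>gm\<close> and \<open>gp\<close> are the one-sided limits of a step function.
  Subtracting the jumps already passed leaves a locally constant function on the connected interval
  \<open>{0..1}\<close>, so its end values agree.\<close>

lemma sum_jumps_zero:
  fixes gp gm :: "real \<Rightarrow> 'a::ab_group_add"
  assumes F: "finite F" "F \<subseteq> {0..<1}"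
    and right: "\<And>t. \<forall>\<^sub>F h in at_right 0. gm (t + h) = gp t"
    and left: "\<And>t. \<forall>\<^sub>F h in at_right 0. gm (t - h) = gm t"
    and off: "\<And>t. t \<in> {0..<1} \<Longrightarrow> t \<notin> F \<Longrightarrow> gp t = gm t"
    and per: "gm 1 = gm 0"
  shows "(\<Sum>t\<in>F. gp t - gm t) = 0"
proof -
  \<comment> \<open>Strict inequality: the jump at \<open>s\<close> counts only beyond
    \<open>s\<close>, matching \<open>gm\<close> as the value from the left. So no jump is counted
    at 0 and all of them are at 1.\<close>
  define H where "H s = gm s - (\<Sum>t\<in>{t\<in>F. t < s}. gp t - gm t)" for s
  have "H 0 = H 1"
  proof (rule connected_local_const[of "{0..1::real}"])
    show "\<forall>s\<in>{0..1}. \<forall>\<^sub>F b in at s within {0..1}. H s = H b"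
    proof
      fix s :: real assume s: "s \<in> {0..1}"
      have "\<forall>\<^sub>F h in at_right 0. \<forall>t\<in>F - {s}. h < \<bar>t - s\<bar>"
        using F by (intro eventually_ball_finite ballI order_tendstoD[where y=0]) auto
      then have "\<forall>\<^sub>F h in at_right 0. gm (s + h) = gp s \<and> gm (s - h) = gm s \<and> (\<forall>t\<in>F - {s}. h < \<bar>t - s\<bar>)"
        using right[of s] left[of s] by (simp add: eventually_conj)
      then obtain \<delta> where \<delta>: "0 < \<delta>" "\<And>h. \<lbrakk>0 < h; h < \<delta>\<rbrakk> \<Longrightarrow>
          gm (s + h) = gp s \<and> gm (s - h) = gm s \<and> (\<forall>t\<in>F - {s}. h < \<bar>t - s\<bar>)"
        unfolding eventually_at_right_field by blast
      have "H s = H b" if b: "b \<in> {0..1}" "b \<noteq> s" "\<bar>b - s\<bar> < \<delta>" for b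
      proof (cases "s < b")
        case True
        have *: "gm b = gp s" "\<forall>t\<in>F - {s}. b - s < \<bar>t - s\<bar>"
          using \<delta>(2)[of "b - s"] True b by auto
        have "{t\<in>F. t < b} = {t\<in>F. t < s} \<union> (F \<inter> {s})" using * True by force
        then have "(\<Sum>t\<in>{t\<in>F. t < b}. gp t - gm t)
            = (\<Sum>t\<in>{t\<in>F. t < s}. gp t - gm t) + (\<Sum>t\<in>F \<inter> {s}. gp t - gm t)"
          using F by (simp add: sum.union_disjoint disjoint_iff)
        also have "(\<Sum>t\<in>F \<inter> {s}. gp t - gm t) = gp s - gm s"
          using off[of s] s b True by (cases "s \<in> F") auto
        finally show ?thesis unfolding H_def * by (simp add: algebra_simps)
      next
        case False
        have *: "gm b = gm s" "\<forall>t\<in>F - {s}. s - b < \<bar>t - s\<bar>"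
          using \<delta>(2)[of "s - b"] False b by auto
        have "{t\<in>F. t < b} = {t\<in>F. t < s}" using * False b by force
        then show ?thesis unfolding H_def * by simp
      qed
      then show "\<forall>\<^sub>F b in at s within {0..1}. H s = H b"
        unfolding eventually_at using \<delta>(1) by (intro exI[of _ \<delta>]) (auto simp: dist_real_def)
    qed
  qed auto
  moreover have "{t\<in>F. t < 0} = {}" "{t\<in>F. t < 1} = F" using F by auto
  ultimately show ?thesis unfolding H_def using per by simp
qed

context diagram
begin

section \<open>The colors of the regions at a crossing\<close>

text \<open>\<open>cross U\<close> sees only the term \<open>\<alpha> T\<close>, so the diagonal
  lies on the same side of the other strand as the half-branch \<alpha>; a third strand would make a
  triple point. By symmetry the same diagonal lies in \<open>sector j u \<beta>\<close>.\<close>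

lemma sector_double_point:
  assumes pq: "((i, t), (j, u)) \<in> crossings D \<or> ((j, u), (i, t)) \<in> crossings D"
    and \<alpha>: "\<alpha> = 1 \<or> \<alpha> = -1" and \<beta>: "\<beta> = 1 \<or> \<beta> = -1"
  shows "\<alpha> *\<^sub>R tangent D (i, t) + \<beta> *\<^sub>R tangent D (j, u) \<in> sector i t \<alpha>"
proof -
  let ?T = "tangent D (i, t)" and ?U = "tangent D (j, u)"
  have params: "(i, t) \<in> params D" "(j, u) \<in> params D" "shadow D (i, t) = shadow D (j, u)"
      "(i, t) \<noteq> (j, u)"
    using pq crossingsD by fastforce+
  have TU: "cross ?T ?U \<noteq> 0"
    using pq crossingsD(5) cross_swap[of ?T ?U] by force
  have "cross ?T (\<alpha> *\<^sub>R ?T + \<beta> *\<^sub>R ?U) \<noteq> 0" using TU \<beta> by (auto simp: cross_simps)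
  moreover have "0 < (\<alpha> * cross (tangent D (k, v)) ?T) * cross (tangent D (k, v)) (\<alpha> *\<^sub>R ?T + \<beta> *\<^sub>R ?U)"
    if k: "k < length D" "shadow D (k, v) = shadow D (i, t)" "cross ?T (tangent D (k, v)) \<noteq> 0" for k v
  proof -
    have "(k, frac v) \<noteq> (i, t)"
      using k at_frac(3)[of k v] by (auto simp: cross_simps)
    then have "(k, frac v) = (j, u)"
      using no_triple_point[OF frac_params[OF k(1), of v] params(1,2)] at_frac(2)[OF k(1), of v] k params by auto
    then have V: "tangent D (k, v) = ?U" using at_frac(3)[OF k(1), of v] by simp
    have "cross ?U ?T \<noteq> 0" using TU cross_swap[of ?T ?U] by auto
    then have "0 < cross ?U ?T * cross ?U ?T" by (metis not_real_square_gt_zero)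
    then show ?thesis unfolding V using \<alpha> by (auto simp: cross_simps)
  qed
  ultimately show ?thesis unfolding sector_def by auto
qed

lemma sector_nonempty:
  assumes "i < length D" "\<sigma> = 1 \<or> \<sigma> = -1"
  obtains d where "d \<in> sector i t \<sigma>"
proof (cases "simple i t")
  case True
  have "cross (tangent D (i, t)) (\<i> * tangent D (i, t)) \<noteq> 0"
    using tangent_nonzero[OF assms(1), of t] by (simp add: cross_ii)
  then show ?thesis using that sector_simple[OF assms(1) True] by auto
next
  case False
  then obtain j u where *: "((i, frac t), (j, u)) \<in> crossings D \<or> ((j, u), (i, frac t)) \<in> crossings D"
    unfolding crossing_point_def by force
  have "sector i (frac t) \<sigma> = sector i t \<sigma>"
    unfolding sector_def using at_frac[OF assms(1), of t] by simp
  then show ?thesis using that sector_double_point[OF * assms(2), of 1] by auto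
qed

text \<open>A one-sided limit, because \<open>left_region\<close> is unreliable at crossings.
  \<open>B\<close> is arbitrary so that existence can be treated separately.\<close>

definition left_black :: "complex set set \<Rightarrow> nat \<Rightarrow> real \<Rightarrow> real \<Rightarrow> bool" where
  "left_black B i t \<sigma> \<longleftrightarrow> (\<forall>\<^sub>F h in at_right 0. left_region i (t + \<sigma> * h) \<in> B)"

lemma checkerboard_sides:
  assumes "checkerboard D B" "i < length D" "simple i t"
  shows "left_region i t \<in> B \<longleftrightarrow> right_region i t \<notin> B"
proof -
  have "q = (i, frac t)" if "q \<in> params D" "shadow D q = shadow D (i, frac t)" for q
    using crossing_of_double_point[OF that(1) frac_params[OF assms(2)] that(2)] assms(3)
    unfolding crossing_point_def by force
  then have "region_towards D (shadow D (i, frac t)) (\<i> * tangent D (i, frac t)) \<in> B \<longleftrightarrow>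
      region_towards D (shadow D (i, frac t)) (- \<i> * tangent D (i, frac t)) \<notin> B"
    using assms(1) frac_params[OF assms(2), of t] unfolding checkerboard_def by blast
  then show ?thesis
    unfolding left_region_def right_region_def using at_frac[OF assms(2), of t] by simp
qed

text \<open>If \<open>d\<close> points to the left, its region is the left region of nearby points;
  if to the right, it is their right region, whose colour is opposite. The inner equivalence covers
  both cases.\<close>

lemma eventually_left_black:
  assumes B: "checkerboard D B" and i: "i < length D" and \<sigma>: "\<sigma> = 1 \<or> \<sigma> = -1" and d: "d \<in> sector i t \<sigma>"
  shows "\<forall>\<^sub>F h in at_right 0. left_region i (t + \<sigma> * h) \<in> B \<longleftrightarrow>
      (region_towards D (shadow D (i, t)) d \<in> B \<longleftrightarrow> 0 < cross (tangent D (i, t)) d)"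
proof (cases "0 < cross (tangent D (i, t)) d")
  case True
  then show ?thesis
    using side_region_along_curve(1)[OF i \<sigma> d] by (auto elim: eventually_mono)
next
  case False
  then have "cross (tangent D (i, t)) d < 0" using d unfolding sector_def by auto
  from side_region_along_curve(2)[OF i \<sigma> d this] eventually_simple[OF \<sigma>, of i t]
  show ?thesis
    using False checkerboard_sides[OF B i] by (auto elim: eventually_elim2)
qed

lemma left_black_iff:
  assumes B: "checkerboard D B" and i: "i < length D" and \<sigma>: "\<sigma> = 1 \<or> \<sigma> = -1" and d: "d \<in> sector i t \<sigma>"
  shows "left_black B i t \<sigma> \<longleftrightarrow>
      (region_towards D (shadow D (i, t)) d \<in> B \<longleftrightarrow> 0 < cross (tangent D (i, t)) d)" (is "_ \<longleftrightarrow> ?R")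
proof -
  have "left_black B i t \<sigma> \<longleftrightarrow> (\<forall>\<^sub>F h in at_right (0::real). ?R)"
    unfolding left_black_def by (rule eventually_subst[OF eventually_left_black[OF assms]])
  then show ?thesis by simp
qed

lemma left_black_locally_constant:
  assumes B: "checkerboard D B" and i: "i < length D" and \<sigma>: "\<sigma> = 1 \<or> \<sigma> = -1"
  shows "\<forall>\<^sub>F h in at_right 0. left_region i (t + \<sigma> * h) \<in> B \<longleftrightarrow> left_black B i t \<sigma>"
proof -
  obtain d where d: "d \<in> sector i t \<sigma>" using sector_nonempty[OF i \<sigma>] by blast
  show ?thesis using eventually_left_black[OF B i \<sigma> d] left_black_iff[OF B i \<sigma> d] by simp
qed

lemma left_black_simple:
  assumes B: "checkerboard D B" and i: "i < length D" "simple i t" and \<sigma>: "\<sigma> = 1 \<or> \<sigma> = -1"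
  shows "left_black B i t \<sigma> \<longleftrightarrow> left_region i t \<in> B"
proof -
  have *: "0 < cross (tangent D (i, t)) (\<i> * tangent D (i, t))"
    using tangent_nonzero[OF i(1), of t] by (simp add: cross_ii)
  then have "\<i> * tangent D (i, t) \<in> sector i t \<sigma>" using sector_simple[OF i] by auto
  from left_black_iff[OF B i(1) \<sigma> this] * show ?thesis unfolding left_region_def by simp
qed

lemma left_black_near:
  assumes B: "checkerboard D B" and i: "i < length D" and \<sigma>: "\<sigma> = 1 \<or> \<sigma> = -1" and \<tau>: "\<tau> = 1 \<or> \<tau> = -1"
  shows "\<forall>\<^sub>F h in at_right 0. left_black B i (t + \<sigma> * h) \<tau> \<longleftrightarrow> left_black B i t \<sigma>"
  using left_black_locally_constant[OF B i \<sigma>, of t] eventually_simple[OF \<sigma>, of i t]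
  by eventually_elim (use left_black_simple[OF B i _ \<tau>] in blast)

text \<open>\<open>reg \<alpha> \<beta>\<close> borders half-branch \<alpha> of the over-strand and
  half-branch \<beta> of the under-strand. The four diagonals yield eight equivalences, and the rest
  is propositional.\<close>

lemma left_black_crossing:
  assumes B: "checkerboard D B" and x: "((i, t), (j, u)) \<in> crossings D"
    and R: "R = region_towards D (shadow D (i, t)) (swept_direction D ((i, t), (j, u)))"
    and R': "R' = region_towards D (shadow D (i, t)) (- swept_direction D ((i, t), (j, u)))"
  shows "R' \<in> B \<longleftrightarrow> R \<in> B"
    and "left_black B i t 1 \<longleftrightarrow> R \<in> B" "left_black B i t (-1) \<longleftrightarrow> R \<notin> B"
    and "left_black B j u 1 \<longleftrightarrow> R \<notin> B" "left_black B j u (-1) \<longleftrightarrow> R \<in> B"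
proof -
  define T where "T = tangent D (i, t)"
  define U where "U = tangent D (j, u)"
  define s where "s = sgn (cross T U)"
  have TU: "cross T U \<noteq> 0" using crossingsD(5)[OF x] unfolding T_def U_def .
  then have s: "s = 1 \<or> s = -1" unfolding s_def by (auto simp: sgn_real_def)
  have ij: "i < length D" "j < length D" using crossingsD(1,2)[OF x] by (auto simp: params_def)
  have z: "shadow D (j, u) = shadow D (i, t)" using crossingsD(3)[OF x] by simp
  define reg where "reg \<alpha> \<beta> = region_towards D (shadow D (i, t)) (\<alpha> *\<^sub>R T + \<beta> *\<^sub>R U)" for \<alpha> \<beta> :: real
  have w: "R = reg 1 s" "R' = reg (-1) (-s)"
    unfolding R R' reg_def by (simp_all add: T_def U_def s_def)
  \<comment> \<open>\<open>cross T\<close> of the diagonal is \<open>\<beta> * cross T U\<close>,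
    whereas \<open>cross U\<close> of it is \<open>- \<alpha> * cross T U\<close>; hence the
    opposite sign in \<open>under\<close>.\<close>
  have over: "left_black B i t \<alpha> \<longleftrightarrow> (reg \<alpha> \<beta> \<in> B \<longleftrightarrow> 0 < \<beta> * cross T U)"
    if "\<alpha> = 1 \<or> \<alpha> = -1" "\<beta> = 1 \<or> \<beta> = -1" for \<alpha> \<beta>
    using left_black_iff[OF B ij(1) that(1) sector_double_point[OF disjI1[OF x] that]]
    unfolding reg_def T_def U_def by (simp add: cross_simps)
  have under: "left_black B j u \<beta> \<longleftrightarrow> (reg \<alpha> \<beta> \<in> B \<longleftrightarrow> \<alpha> * cross T U < 0)"
    if "\<alpha> = 1 \<or> \<alpha> = -1" "\<beta> = 1 \<or> \<beta> = -1" for \<alpha> \<beta>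
    using left_black_iff[OF B ij(2) that(2) sector_double_point[OF disjI2[OF x] that(2,1)]]
      cross_swap[of U T] z
    unfolding reg_def T_def U_def by (simp add: cross_simps add.commute)
  consider "s = 1" "0 < cross T U" | "s = -1" "cross T U < 0"
    using s TU unfolding s_def by (auto simp: sgn_real_def split: if_splits)
  then have "(R' \<in> B \<longleftrightarrow> R \<in> B) \<and> (left_black B i t 1 \<longleftrightarrow> R \<in> B) \<and> (left_black B i t (-1) \<longleftrightarrow> R \<notin> B) \<and>
      (left_black B j u 1 \<longleftrightarrow> R \<notin> B) \<and> (left_black B j u (-1) \<longleftrightarrow> R \<in> B)"
    using over[of 1 1] over[of 1 "-1"] over[of "-1" 1] over[of "-1" "-1"]
      under[of 1 1] under[of 1 "-1"] under[of "-1" 1] under[of "-1" "-1"]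
    unfolding w by cases auto
  then show "R' \<in> B \<longleftrightarrow> R \<in> B"
    and "left_black B i t 1 \<longleftrightarrow> R \<in> B" "left_black B i t (-1) \<longleftrightarrow> R \<notin> B"
    and "left_black B j u 1 \<longleftrightarrow> R \<notin> B" "left_black B j u (-1) \<longleftrightarrow> R \<in> B"
    by auto
qed

section \<open>Arcs\<close>

definition cut_link :: "(complex \<times> real) set" where
  "cut_link = point D ` params D - point D ` snd ` crossings D"

lemma point_inj: "inj_on (point D) (params D)"
  using link_diagram by (simp add: link_diagram_def oriented_link_def)

lemma under_subset_params: "snd ` crossings D \<subseteq> params D"
  using crossingsD(2) by force

lemma in_cut_link:
  assumes "i < length D" "(i, frac t) \<notin> snd ` crossings D"
  shows "point D (i, t) \<in> cut_link"
proof -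
  have p: "(i, frac t) \<in> params D" using frac_params assms by blast
  then have "point D (i, frac t) \<notin> point D ` snd ` crossings D"
    using inj_on_image_mem_iff[OF point_inj p under_subset_params] assms(2) by blast
  then show ?thesis unfolding cut_link_def using p at_frac(1)[OF assms(1)] by (metis DiffI imageI)
qed

text \<open>A short open half-branch meets no crossing parameter, so it survives the cutting and is
  a connected witness inside one arc.\<close>

lemma arc_towards_germ:
  assumes i: "i < length D" and \<sigma>: "\<sigma> = 1 \<or> \<sigma> = -1"
  obtains X \<delta> where "0 < \<delta>" "connected X" "X \<subseteq> cut_link"
    "X = (\<lambda>h. point D (i, t + \<sigma> * h)) ` {0<..<\<delta>}"
proof -
  obtain \<delta> where \<delta>: "0 < \<delta>" "\<And>h. \<lbrakk>0 < h; h < \<delta>\<rbrakk> \<Longrightarrow> simple i (t + \<sigma> * h)"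
    using eventually_simple[OF \<sigma>, of i t] unfolding eventually_at_right_field by auto
  have "continuous_on {0<..<\<delta>} (\<lambda>h. point D (i, t + \<sigma> * h))"
    by (rule continuous_on_compose2[OF shadow_derivative(3)[OF i]]) (auto intro!: continuous_intros)
  then have "connected ((\<lambda>h. point D (i, t + \<sigma> * h)) ` {0<..<\<delta>})"
    by (intro connected_continuous_image) auto
  moreover have "point D (i, t + \<sigma> * h) \<in> cut_link" if "0 < h" "h < \<delta>" for h
    using \<delta>(2)[OF that] i unfolding crossing_point_def by (intro in_cut_link) auto
  ultimately show ?thesis by (intro that[OF \<delta>(1) _ _ refl]) auto
qed

lemma arc_towards_eq:
  assumes "connected X" "X \<subseteq> cut_link" "x \<in> X" "\<forall>\<^sub>F h in at_right 0. point D (i, t + \<sigma> * h) \<in> X"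
  shows "arc_towards D (i, t) \<sigma> = connected_component_set cut_link x"
    "arc_towards D (i, t) \<sigma> \<in> arcs D"
proof -
  note * = the_component_entered[OF assms]
  show "arc_towards D (i, t) \<sigma> = connected_component_set cut_link x"
    unfolding arc_towards_def arcs_def cut_link_def[symmetric] shift_def fst_conv snd_conv by (rule *)
  then show "arc_towards D (i, t) \<sigma> \<in> arcs D"
    unfolding arcs_def cut_link_def[symmetric] using *(2) by simp
qed

lemma arc_towards_near:
  assumes i: "i < length D" and \<sigma>: "\<sigma> = 1 \<or> \<sigma> = -1" and \<tau>: "\<tau> = 1 \<or> \<tau> = -1"
  shows "\<forall>\<^sub>F h in at_right 0. arc_towards D (i, t + \<sigma> * h) \<tau> = arc_towards D (i, t) \<sigma>"
    and "arc_towards D (i, t) \<sigma> \<in> arcs D"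
proof -
  obtain X \<delta> where \<delta>: "0 < \<delta>" and X: "connected X" "X \<subseteq> cut_link"
    and X_eq: "X = (\<lambda>h. point D (i, t + \<sigma> * h)) ` {0<..<\<delta>}"
    using arc_towards_germ[OF i \<sigma>] by metis
  have inX: "point D (i, t + \<sigma> * h) \<in> X" if "0 < h" "h < \<delta>" for h using that X_eq by auto
  note x = inX[of "\<delta> / 2", simplified, OF \<delta>]
  have ev: "\<forall>\<^sub>F h in at_right 0. point D (i, t + \<sigma> * h) \<in> X"
    using eventually_at_right_0_less[OF \<delta>] by eventually_elim (use inX in auto)
  note eq = arc_towards_eq[OF X x ev]
  show "arc_towards D (i, t) \<sigma> \<in> arcs D" by (rule eq)
  show "\<forall>\<^sub>F h in at_right 0. arc_towards D (i, t + \<sigma> * h) \<tau> = arc_towards D (i, t) \<sigma>"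
    using eventually_at_right_0_less[OF \<delta>]
  proof eventually_elim
    case (elim h)
    have "\<forall>\<^sub>F e in at_right 0. 0 < e \<and> e < min h (\<delta> - h)"
      using elim by (intro eventually_at_right_0_less) auto
    then have "\<forall>\<^sub>F e in at_right 0. point D (i, t + \<sigma> * h + \<tau> * e) \<in> X"
    proof eventually_elim
      case e: (elim e)
      \<comment> \<open>As \<open>\<sigma> * \<sigma> = 1\<close>, a step in direction \<tau> is
        again a point of the half-branch, now with parameter
        \<open>h + \<sigma> * \<tau> * e\<close>.\<close>
      have "t + \<sigma> * h + \<tau> * e = t + \<sigma> * (h + \<sigma> * \<tau> * e)" using \<sigma> by (auto simp: algebra_simps)
      moreover have "0 < h + \<sigma> * \<tau> * e" "h + \<sigma> * \<tau> * e < \<delta>" using e \<sigma> \<tau> elim by auto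
      ultimately show ?case using inX by metis
    qed
    from arc_towards_eq(1)[OF X x this] eq(1) show ?case by simp
  qed
qed

text \<open>Away from under-points the point itself can be added to the half-branch without leaving
  the cut link. Applied at over-points with both signs, this is why an arc continues through an
  over-crossing.\<close>

lemma arc_through_eq:
  assumes i: "i < length D" and t: "(i, frac t) \<notin> snd ` crossings D" and \<sigma>: "\<sigma> = 1 \<or> \<sigma> = -1"
  shows "arc_through D (i, t) = arc_towards D (i, t) \<sigma>"
proof -
  obtain X \<delta> where \<delta>: "0 < \<delta>" and X: "connected X" "X \<subseteq> cut_link"
    and X_eq: "X = (\<lambda>h. point D (i, t + \<sigma> * h)) ` {0<..<\<delta>}"
    using arc_towards_germ[OF i \<sigma>] by metis
  let ?p = "\<lambda>h. point D (i, t + \<sigma> * h)"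
  have ins: "?p ` {0..<\<delta>} = insert (point D (i, t)) X"
  proof -
    have "{0..<\<delta>} = insert 0 {0<..<\<delta>}" using \<delta> by auto
    then have "?p ` {0..<\<delta>} = insert (?p 0) X" unfolding X_eq by (simp only: image_insert)
    then show ?thesis by simp
  qed
  have "continuous_on {0..<\<delta>} ?p"
    by (rule continuous_on_compose2[OF shadow_derivative(3)[OF i]]) (auto intro!: continuous_intros)
  then have "connected (insert (point D (i, t)) X)"
    unfolding ins[symmetric] by (intro connected_continuous_image) auto
  moreover have "insert (point D (i, t)) X \<subseteq> cut_link"
    using in_cut_link[OF i t] X(2) by simp
  moreover have "\<forall>\<^sub>F h in at_right 0. ?p h \<in> insert (point D (i, t)) X"
    using eventually_at_right_0_less[OF \<delta>] by eventually_elim (auto simp: X_eq)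
  ultimately have *: "arc_towards D (i, t) \<sigma> = connected_component_set cut_link (point D (i, t))"
      "arc_towards D (i, t) \<sigma> \<in> arcs D"
    using arc_towards_eq[of "insert (point D (i, t)) X" "point D (i, t)"] by auto
  have mem: "point D (i, t) \<in> arc_towards D (i, t) \<sigma>"
    unfolding *(1) using in_cut_link[OF i t] by simp
  show ?thesis
    unfolding arc_through_def
  proof (rule the_equality)
    fix \<alpha> assume "\<alpha> \<in> arcs D \<and> point D (i, t) \<in> \<alpha>"
    then show "\<alpha> = arc_towards D (i, t) \<sigma>"
      using *(2) mem components_eq unfolding arcs_def by blast
  qed (use * mem in auto)
qed

text \<open>A point that is over at one crossing and under at another would belong to three points
  of different heights with one shadow, a triple point.\<close>

lemma over_under_disjoint: "fst ` crossings D \<inter> snd ` crossings D = {}"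
proof -
  have False if "(p, q) \<in> crossings D" "(r, p) \<in> crossings D" for p q r
    using crossingsD(1-4)[OF that(1)] crossingsD(1-4)[OF that(2)] no_triple_point[of q p r]
    by (metis less_irrefl less_trans)
  then show ?thesis by force
qed

lemma crossings_inj: "inj_on fst (crossings D)" "inj_on snd (crossings D)"
proof -
  have "q = r" if "(p, q) \<in> crossings D" "(p, r) \<in> crossings D" for p q r
    using crossingsD(1-4)[OF that(1)] crossingsD(1-4)[OF that(2)] no_triple_point[of q p r]
    by (metis less_irrefl less_trans)
  then show "inj_on fst (crossings D)" by (auto simp: inj_on_def)
  have "q = r" if "(q, p) \<in> crossings D" "(r, p) \<in> crossings D" for p q r
    using crossingsD(1-4)[OF that(1)] crossingsD(1-4)[OF that(2)] no_triple_point[of q p r]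
    by (metis less_irrefl less_trans)
  then show "inj_on snd (crossings D)" by (auto simp: inj_on_def)
qed

section \<open>The alternating sum over the crossings\<close>

lemma frac_of_param: "(i, t) \<in> params D \<Longrightarrow> frac t = t"
  by (simp add: params_def frac_eq)

lemma over_arc_eq:
  assumes "((i, t), q) \<in> crossings D" "\<sigma> = 1 \<or> \<sigma> = -1"
  shows "over_arc D ((i, t), q) = arc_towards D (i, t) \<sigma>"
proof -
  have p: "(i, t) \<in> params D" using crossingsD(1)[OF assms(1)] .
  have "(i, t) \<in> fst ` crossings D" using assms(1) by force
  then have "(i, frac t) \<notin> snd ` crossings D"
    using over_under_disjoint frac_of_param[OF p] by auto
  then show ?thesis using arc_through_eq[OF _ _ assms(2)] p by (simp add: params_def)
qed

lemma crossing_arcs: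
  assumes "x \<in> crossings D"
  shows "over_arc D x \<in> arcs D" "left_under_arc D x \<in> arcs D" "right_under_arc D x \<in> arcs D"
proof -
  obtain i t j u where x: "x = ((i, t), (j, u))" by (metis surj_pair)
  have ij: "i < length D" "j < length D"
    using crossingsD(1,2)[OF assms[unfolded x]] by (auto simp: params_def)
  have "sgn (cross (tangent D (i, t)) (tangent D (j, u))) = 1 \<or>
      sgn (cross (tangent D (i, t)) (tangent D (j, u))) = -1"
    using crossingsD(5)[OF assms[unfolded x]] by (auto simp: sgn_real_def)
  then show "left_under_arc D x \<in> arcs D" "right_under_arc D x \<in> arcs D"
    using arc_towards_near(2)[OF ij(2), of _ 1] unfolding x by auto
  show "over_arc D x \<in> arcs D"
    unfolding x using over_arc_eq[OF assms[unfolded x], of 1] arc_towards_near(2)[OF ij(1), of _ 1] by simp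
qed

lemma alternating_sum_zero:
  fixes f :: "(complex \<times> real) set \<Rightarrow> 'a::ab_group_add"
  assumes B: "checkerboard D (black D)"
  shows "(\<Sum>x\<in>crossings D.
    let v = f (left_under_arc D x) + f (right_under_arc D x) - (f (over_arc D x) + f (over_arc D x))
    in if pos_sign D x = 1 then v else - v) = 0"
proof -
  \<comment> \<open>The one-sided limits of the step function at \<open>t\<close>:
    \<open>\<sigma> = 1\<close> just after it, \<open>\<sigma> = -1\<close> just before it.
    \<open>J\<close> is the jump.\<close>
  define g where "g i \<sigma> t =
    (if left_black (black D) i t \<sigma> then f (arc_towards D (i, t) \<sigma>) else - f (arc_towards D (i, t) \<sigma>))"
    for i \<sigma> t
  define J where "J p = g (fst p) 1 (snd p) - g (fst p) (-1) (snd p)" for p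
  define X where "X = fst ` crossings D \<union> snd ` crossings D"
  have X: "finite X" "X \<subseteq> params D"
    unfolding X_def using finite_crossings crossingsD(1,2) by force+
  have near: "\<forall>\<^sub>F h in at_right 0. g i \<tau> (t + \<sigma> * h) = g i \<sigma> t"
    if "i < length D" "\<sigma> = 1 \<or> \<sigma> = -1" "\<tau> = 1 \<or> \<tau> = -1" for i t \<sigma> \<tau>
    using left_black_near[OF B that, of t] arc_towards_near(1)[OF that, of t]
    by eventually_elim (simp add: g_def)
  have circle: "(\<Sum>t | (i, t) \<in> X. J (i, t)) = 0" if i: "i < length D" for i
  proof -
    have "(\<Sum>t\<in>{t. (i, t) \<in> X}. g i 1 t - g i (-1) t) = 0"
    proof (rule sum_jumps_zero)
      have "{t. (i, t) \<in> X} \<subseteq> snd ` X" by force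
      then show "finite {t. (i, t) \<in> X}" using X(1) finite_subset by blast
      show "{t. (i, t) \<in> X} \<subseteq> {0..<1}" using X(2) by (auto simp: params_def)
      show "\<forall>\<^sub>F h in at_right 0. g i (-1) (t + h) = g i 1 t" for t
        using near[OF i, of 1 "-1" t] by simp
      show "\<forall>\<^sub>F h in at_right 0. g i (-1) (t - h) = g i (-1) t" for t
        using near[OF i, of "-1" "-1" t] by simp
      show "g i 1 t = g i (-1) t" if "t \<in> {0..<1}" "t \<notin> {t. (i, t) \<in> X}" for t
      proof -
        have s: "simple i t" using that unfolding crossing_point_def X_def by (simp add: frac_eq)
        have u: "(i, frac t) \<notin> snd ` crossings D" using that unfolding X_def by (simp add: frac_eq)
        show ?thesis
          unfolding g_def
          using left_black_simple[OF B i s, of 1] left_black_simple[OF B i s, of "-1"]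
            arc_through_eq[OF i u, of 1] arc_through_eq[OF i u, of "-1"] by simp
      qed
      \<comment> \<open>The limits from the left at 0 and at 1 agree by periodicity, which closes
        the circle even if 0 is a crossing parameter.\<close>
      have "left_region i (1 - r) = left_region i (- r)" for r
        unfolding left_region_def using shadow_periodic[OF i, of 1 "- r"] tangent_periodic[OF i, of 1 "- r"]
        by simp
      then have "left_black (black D) i 1 (-1) = left_black (black D) i 0 (-1)"
        unfolding left_black_def by simp
      moreover have "point D (i, 1 - r) = point D (i, - r)" for r
        using point_periodic[OF i, of 1 "- r"] by simp
      then have "arc_towards D (i, 1) (-1) = arc_towards D (i, 0) (-1)"
        unfolding arc_towards_def shift_def by simp
      ultimately show "g i (-1) 1 = g i (-1) 0" unfolding g_def by simp
    qed
    then show ?thesis unfolding J_def by simp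
  qed
  have over: "J (fst x) = (let v = f (over_arc D x) + f (over_arc D x) in if pos_sign D x = 1 then v else - v)"
    and under: "J (snd x) = (let v = f (left_under_arc D x) + f (right_under_arc D x) in if pos_sign D x = 1 then - v else v)"
    if x: "x \<in> crossings D" for x
  proof -
    obtain i t j u where x_eq: "x = ((i, t), (j, u))" by (metis surj_pair)
    note x' = x[unfolded x_eq]
    note lb = left_black_crossing[OF B x' refl refl]
    define R where "R \<longleftrightarrow> region_towards D (shadow D (i, t)) (swept_direction D ((i, t), (j, u))) \<in> black D"
    \<comment> \<open>Opposite sectors have equal colours, so the test of both in
      \<open>pos_sign\<close> reduces to one.\<close>
    have sign: "pos_sign D x = 1 \<longleftrightarrow> R"
      unfolding pos_sign_def x_eq Let_def R_def fst_conv using lb(1) by auto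
    show "J (fst x) = (let v = f (over_arc D x) + f (over_arc D x) in if pos_sign D x = 1 then v else - v)"
      unfolding sign J_def g_def using lb(2,3) over_arc_eq[OF x', of 1] over_arc_eq[OF x', of "-1"]
      unfolding x_eq R_def[symmetric] fst_conv snd_conv Let_def by (auto simp: algebra_simps)
    define s where "s = sgn (cross (tangent D (i, t)) (tangent D (j, u)))"
    have "s = 1 \<or> s = -1"
      using crossingsD(5)[OF x'] unfolding s_def by (auto simp: sgn_real_def)
    \<comment> \<open>The sign \<open>s\<close> decides which of the forward and backward arcs is
      the left one; the sum is symmetric in them.\<close>
    then have "f (left_under_arc D x) + f (right_under_arc D x)
        = f (arc_towards D (j, u) 1) + f (arc_towards D (j, u) (-1))"
      unfolding x_eq left_under_arc.simps right_under_arc.simps s_def[symmetric] by (auto simp: add.commute)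
    then show "J (snd x) = (let v = f (left_under_arc D x) + f (right_under_arc D x) in if pos_sign D x = 1 then - v else v)"
      unfolding sign J_def g_def using lb(4,5)
      unfolding x_eq R_def[symmetric] fst_conv snd_conv Let_def by (auto simp: algebra_simps)
  qed
  \<comment> \<open>Every point of \<open>X\<close> is the over-point or the under-point of exactly
    one crossing, so the sum over crossings becomes one over points.\<close>
  have "(\<Sum>x\<in>crossings D. J (fst x) + J (snd x)) = (\<Sum>p\<in>X. J p)"
    unfolding X_def using finite_crossings over_under_disjoint crossings_inj
    by (simp add: sum.distrib sum.union_disjoint sum.reindex)
  also have "X = (SIGMA i:{..<length D}. {t. (i, t) \<in> X})"
    using X(2) by (auto simp: params_def)
  also have "sum J \<dots> = (\<Sum>i<length D. \<Sum>t | (i, t) \<in> X. J (i, t))"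
  proof -
    have "finite {t. (i, t) \<in> X}" for i
      using finite_subset[of "{t. (i, t) \<in> X}" "snd ` X"] X(1) by force
    then show ?thesis by (subst sum.Sigma) auto
  qed
  also have "\<dots> = 0" using circle by simp
  finally have "(\<Sum>x\<in>crossings D. - (J (fst x) + J (snd x))) = 0" by (simp only: sum_negf minus_zero)
  then show ?thesis
    by (rule trans[rotated]) (intro sum.cong refl, simp add: over under Let_def algebra_simps)
qed

end

section \<open>Existence of the checkerboard coloring\<close>

text \<open>The factor \<open>c\<close> turns the path away from the cut of the principal branch.
  Then \<open>Ln (c * (p x - w)) - Ln c\<close> is a continuous logarithm of \<open>p x - w\<close>,
  and its increment measures the winding.\<close>

lemma winding_number_eq_Ln:
  assumes p: "path p" and c: "c \<noteq> 0"
    and off: "\<And>x. x \<in> {0..1} \<Longrightarrow> c * (p x - w) \<notin> \<real>\<^sub>\<le>\<^sub>0"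
  shows "winding_number p w =
    (Ln (c * (pathfinish p - w)) - Ln (c * (pathstart p - w))) / (2 * of_real pi * \<i>)"
proof -
  define q where "q x = Ln (c * (p x - w)) - Ln c" for x
  have "path q"
    using p off unfolding path_def q_def by (intro continuous_intros) auto
  then have "winding_number (exp \<circ> q) 0 = (pathfinish q - pathstart q) / (2 * of_real pi * \<i>)"
    by (rule winding_number_compose_exp)
  moreover have "winding_number (exp \<circ> q) 0 = winding_number (\<lambda>x. p x - w) 0"
  proof (rule winding_number_cong)
    fix x :: real assume "0 \<le> x" "x \<le> 1"
    then have "c * (p x - w) \<noteq> 0" using off[of x] by auto
    then show "(exp \<circ> q) x = p x - w" unfolding q_def using c by (simp add: exp_diff)
  qed
  ultimately show ?thesis
    by (simp add: winding_number_offset[of p w] q_def pathfinish_def pathstart_def)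
qed

text \<open>The source of the unit jump: an end point in the upper and a start point in the lower
  half-plane contribute \<open>pi i\<close> and \<open>- pi i\<close>, with difference
  \<open>2 pi i\<close>.\<close>

lemma Ln_jump:
  "0 < Im z \<Longrightarrow> Ln z - Ln (- z) = of_real pi * \<i>"
  "Im z < 0 \<Longrightarrow> Ln z - Ln (- z) = - (of_real pi * \<i>)"
  using Ln_minus[of z] by (cases "z = 0"; simp add: mult.commute)+

text \<open>Seen from the left of the tangent direction \<open>T\<close>, the path runs in the domain of the branch of
  the logarithm cut along the left normal; seen from the right, in that of the branch cut
  along the right normal. In the limit the two branches agree at the end of the path and differ by
  \<open>2 \<pi> \<i>\<close> at its start.\<close>

lemma winding_number_jump_cone:
  fixes T z :: complex
  assumes p: "path p" and T: "T \<noteq> 0"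
    and cone: "\<And>x. x \<in> {0..1} \<Longrightarrow> Re ((p x - z) / T) = 0 \<Longrightarrow> p x = z"
    and start: "Re ((pathstart p - z) / T) < 0" and finish: "0 < Re ((pathfinish p - z) / T)"
  shows "((\<lambda>e. winding_number p (z + e *\<^sub>R (\<i> * T)) - winding_number p (z + e *\<^sub>R (- \<i> * T))) \<longlongrightarrow> 1)
    (at_right 0)"
proof -
  let ?F = "at_right (0::real)"
  define L where "L s y e = Ln (s * \<i> / T * (y - (z + e *\<^sub>R (s * \<i> * T))))" for s y :: complex and e :: real
  \<comment> \<open>The rotation by \<open>s * \<i> / T\<close> turns the displacement of the base
    point into the shift \<open>+ e\<close> for both signs \<open>s\<close>. So the rotated path
    takes the value \<open>e > 0\<close> where it meets \<open>z\<close>, and has nonzero imaginary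
    part elsewhere.\<close>
  have arg: "s * \<i> / T * (y - (z + e *\<^sub>R (s * \<i> * T))) = s * \<i> * ((y - z) / T) + of_real e"
    if "s = 1 \<or> s = -1" for s y e
    using that T by (auto simp: field_simps scaleR_conv_of_real)
  have wn: "\<forall>\<^sub>F e in ?F. winding_number p (z + e *\<^sub>R (s * \<i> * T))
      = (L s (pathfinish p) e - L s (pathstart p) e) / (2 * of_real pi * \<i>)"
    if s: "s = 1 \<or> s = -1" for s
    using eventually_at_right_less[of 0]
  proof eventually_elim
    case (elim e)
    have "s * \<i> / T * (p x - (z + e *\<^sub>R (s * \<i> * T))) \<notin> \<real>\<^sub>\<le>\<^sub>0" if x: "x \<in> {0..1}" for x
    proof (cases "Re ((p x - z) / T) = 0")
      case True
      then have "p x = z" using cone x by blast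
      then show ?thesis unfolding arg[OF s] using elim by (auto simp: complex_nonpos_Reals_iff)
    next
      case False
      define \<zeta> where "\<zeta> = (p x - z) / T"
      show ?thesis
        using False s unfolding arg[OF s] \<zeta>_def[symmetric] by (auto simp: complex_nonpos_Reals_iff)
    qed
    then show ?case unfolding L_def using p T s by (intro winding_number_eq_Ln) auto
  qed
  have lim: "(L s y \<longlongrightarrow> Ln (s * \<i> * ((y - z) / T))) ?F"
    if s: "s = 1 \<or> s = -1" and y: "Re ((y - z) / T) \<noteq> 0" for s y
  proof -
    define \<zeta> where "\<zeta> = (y - z) / T"
    have "s * \<i> * ((y - z) / T) + of_real 0 \<notin> \<real>\<^sub>\<le>\<^sub>0"
      using s y unfolding \<zeta>_def[symmetric] by (auto simp: complex_nonpos_Reals_iff)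
    then have "((\<lambda>e. Ln (s * \<i> * ((y - z) / T) + of_real e)) \<longlongrightarrow> Ln (s * \<i> * ((y - z) / T) + of_real 0)) ?F"
      by (intro tendsto_intros) auto
    then show ?thesis unfolding L_def arg[OF s] by simp
  qed
  define a where "a = \<i> * ((pathstart p - z) / T)"
  define b where "b = \<i> * ((pathfinish p - z) / T)"
  have "((\<lambda>e. (L 1 (pathfinish p) e - L 1 (pathstart p) e) / (2 * of_real pi * \<i>)
      - (L (-1) (pathfinish p) e - L (-1) (pathstart p) e) / (2 * of_real pi * \<i>)) \<longlongrightarrow>
      (Ln (1 * \<i> * ((pathfinish p - z) / T)) - Ln (1 * \<i> * ((pathstart p - z) / T))) / (2 * of_real pi * \<i>)
      - (Ln (-1 * \<i> * ((pathfinish p - z) / T)) - Ln (-1 * \<i> * ((pathstart p - z) / T))) / (2 * of_real pi * \<i>)) ?F"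
    using start finish by (intro tendsto_intros lim) auto
  also have "(Ln (1 * \<i> * ((pathfinish p - z) / T)) - Ln (1 * \<i> * ((pathstart p - z) / T))) / (2 * of_real pi * \<i>)
      - (Ln (-1 * \<i> * ((pathfinish p - z) / T)) - Ln (-1 * \<i> * ((pathstart p - z) / T))) / (2 * of_real pi * \<i>)
      = ((Ln b - Ln (- b)) - (Ln a - Ln (- a))) / (2 * of_real pi * \<i>)"
    unfolding a_def b_def by (simp add: diff_divide_distrib)
  also have "\<dots> = 1"
  proof -
    have "0 < Im b" "Im a < 0" unfolding a_def b_def using start finish by (simp_all only: Im_i_times)
    then show ?thesis unfolding Ln_jump(1)[OF \<open>0 < Im b\<close>] Ln_jump(2)[OF \<open>Im a < 0\<close>] by simp
  qed
  finally show ?thesis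
    by (rule Lim_transform_eventually)
       (use wn[of 1] wn[of "-1"] in \<open>auto elim: eventually_elim2\<close>)
qed

text \<open>The path is cut at \<open>c - \<delta>\<close> and \<open>c + \<delta>\<close>. The
  outer pieces miss \<open>z\<close>, so their winding numbers are continuous there and do not jump;
  the middle piece meets the normal line only at \<open>z\<close> and contributes 1 in the limit. As
  the path is closed, the difference is an integer, so the limit is attained.\<close>

lemma winding_number_jump:
  fixes T z :: complex
  assumes p: "path p" "pathfinish p = pathstart p" and T: "T \<noteq> 0" and c: "0 < c" "c < 1"
    and z: "\<And>x. x \<in> {0..1} \<Longrightarrow> p x = z \<longleftrightarrow> x = c"
    and deriv: "(p has_vector_derivative T) (at c)"
    and off: "\<forall>\<^sub>F e in at_right 0. z + e *\<^sub>R (\<i> * T) \<notin> path_image p \<and> z + e *\<^sub>R (- \<i> * T) \<notin> path_image p"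
  shows "\<forall>\<^sub>F e in at_right 0. winding_number p (z + e *\<^sub>R (\<i> * T)) = winding_number p (z + e *\<^sub>R (- \<i> * T)) + 1"
proof -
  have pc: "p c = z" using z[of c] c by auto
  obtain \<rho> where \<rho>: "0 < \<rho>" "\<And>x. \<bar>x - c\<bar> < \<rho> \<Longrightarrow> norm (p x - p c - (x - c) *\<^sub>R T) \<le> norm T / 2 * \<bar>x - c\<bar>"
  proof -
    have "(p has_derivative (\<lambda>h. h *\<^sub>R T)) (at c)"
      using deriv by (simp add: has_vector_derivative_def)
    then show ?thesis
      using that T unfolding has_derivative_at_alt
      by (metis half_gt_zero_iff norm_ge_zero real_norm_def zero_less_norm_iff)
  qed
  \<comment> \<open>After division by \<open>T\<close> the real part differs from
    \<open>x - c\<close> by at most half of it, so near \<open>c\<close> it has the sign of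
    \<open>x - c\<close> and vanishes only at \<open>c\<close>.\<close>
  have Re: "\<bar>Re ((p x - z) / T) - (x - c)\<bar> \<le> \<bar>x - c\<bar> / 2" if "\<bar>x - c\<bar> < \<rho>" for x
  proof -
    have "(p x - p c - (x - c) *\<^sub>R T) / T = (p x - z) / T - of_real (x - c)"
      using T pc by (simp add: field_simps scaleR_conv_of_real)
    then have "norm ((p x - z) / T - of_real (x - c)) = norm (p x - p c - (x - c) *\<^sub>R T) / norm T"
      by (metis norm_divide)
    also have "\<dots> \<le> \<bar>x - c\<bar> / 2"
      using \<rho>(2)[OF that] T by (simp add: field_simps)
    finally have "norm ((p x - z) / T - of_real (x - c)) \<le> \<bar>x - c\<bar> / 2" .
    then show ?thesis
      using abs_Re_le_cmod[of "(p x - z) / T - of_real (x - c)"] by simp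
  qed
  define \<delta> where "\<delta> = min (\<rho> / 2) (min c (1 - c) / 2)"
  have \<delta>: "0 < \<delta>" "\<delta> < \<rho>" "0 < c - \<delta>" "c + \<delta> < 1"
    unfolding \<delta>_def using \<rho>(1) c by (auto simp: min_def field_simps)
  define u where "u = c - \<delta>"
  define v where "v = c + \<delta>"
  have uv: "u \<in> {0..1}" "v \<in> {0..1}" "0 \<le> u" "u < c" "c < v" "v \<le> 1" unfolding u_def v_def using \<delta> by auto
  define \<Delta> where "\<Delta> q e = winding_number q (z + e *\<^sub>R (\<i> * T)) - winding_number q (z + e *\<^sub>R (- \<i> * T))"
    for q and e :: real
  have mid: "(\<Delta> (subpath u v p) \<longlongrightarrow> 1) (at_right 0)"
    unfolding \<Delta>_def
  proof (rule winding_number_jump_cone)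
    show "path (subpath u v p)" using p uv by (simp add: path_subpath)
    have "Re ((p u - z) / T) < 0" using Re[of u] \<delta> unfolding u_def abs_le_iff by auto
    then show "Re ((pathstart (subpath u v p) - z) / T) < 0" by simp
    have "0 < Re ((p v - z) / T)" using Re[of v] \<delta> unfolding v_def abs_le_iff by auto
    then show "0 < Re ((pathfinish (subpath u v p) - z) / T)" by simp
    fix x :: real assume x: "x \<in> {0..1}" "Re ((subpath u v p x - z) / T) = 0"
    define y where "y = (v - u) * x + u"
    have "y = u + 2 * \<delta> * x" unfolding y_def u_def v_def by (simp add: algebra_simps)
    moreover have "2 * \<delta> * x \<le> 2 * \<delta>" "0 \<le> 2 * \<delta> * x" using x(1) \<delta>(1) by auto
    ultimately have "\<bar>y - c\<bar> \<le> \<delta>" unfolding u_def by auto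
    moreover have "Re ((p y - z) / T) = 0" using x(2) unfolding subpath_def y_def .
    ultimately have "y = c" using Re[of y] \<delta>(2) abs_minus_commute[of c y] by auto
    then show "subpath u v p x = z" using pc unfolding subpath_def y_def by simp
  qed (rule T)
  have side: "(\<Delta> (subpath a b p) \<longlongrightarrow> 0) (at_right 0)"
    if ab: "a \<in> {0..1}" "b \<in> {0..1}" "c \<notin> closed_segment a b" for a b
  proof -
    have "closed_segment a b \<subseteq> {0..1}" using ab by (simp add: closed_segment_subset)
    then have "p x \<noteq> z" if "x \<in> closed_segment a b" for x
      using z[of x] that ab(3) by blast
    then have "z \<notin> path_image (subpath a b p)" unfolding path_image_subpath_gen by blast
    then have "isCont (winding_number (subpath a b p)) z"
      using p ab by (intro continuous_at_winding_number) (auto simp: path_subpath)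
    moreover have "((\<lambda>e. z + e *\<^sub>R w) \<longlongrightarrow> z) (at_right 0)" for w
      by (auto intro!: tendsto_eq_intros)
    ultimately have "((\<lambda>e. winding_number (subpath a b p) (z + e *\<^sub>R w)) \<longlongrightarrow> winding_number (subpath a b p) z) (at_right 0)" for w
      by (rule isCont_tendsto_compose)
    from tendsto_diff[OF this[of "\<i> * T"] this[of "- \<i> * T"]] show ?thesis unfolding \<Delta>_def by simp
  qed
  have "(\<Delta> (subpath 0 u p) \<longlongrightarrow> 0) (at_right 0)" "(\<Delta> (subpath v 1 p) \<longlongrightarrow> 0) (at_right 0)"
    using uv by (auto intro!: side simp: closed_segment_eq_real_ivl)
  with mid have "((\<lambda>e. \<Delta> (subpath 0 u p) e + \<Delta> (subpath u v p) e + \<Delta> (subpath v 1 p) e) \<longlongrightarrow> 0 + 1 + 0) (at_right 0)"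
    by (intro tendsto_add)
  then have lim: "((\<lambda>e. \<Delta> (subpath 0 u p) e + \<Delta> (subpath u v p) e + \<Delta> (subpath v 1 p) e) \<longlongrightarrow> 1) (at_right 0)"
    by simp
  have split: "winding_number (subpath 0 u p) w + winding_number (subpath u v p) w + winding_number (subpath v 1 p) w
      = winding_number p w" if "w \<notin> path_image p" for w
    using winding_number_subpath_combine[OF p(1) that, of 0 u v]
      winding_number_subpath_combine[OF p(1) that, of 0 v 1] uv by simp
  have "(\<Delta> p \<longlongrightarrow> 1) (at_right 0)"
    by (rule Lim_transform_eventually[OF lim], use off in eventually_elim)
       (use split in \<open>simp add: \<Delta>_def algebra_simps\<close>)
  then have "\<forall>\<^sub>F e in at_right 0. dist (\<Delta> p e) 1 < 1"
    by (rule tendstoD) simp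
  with off show ?thesis
  proof eventually_elim
    case (elim e)
    have "winding_number p w \<in> \<int>" if "w \<notin> path_image p" for w
      using integer_winding_number_eq[OF p(1) that] p(2) by simp
    then have "\<Delta> p e \<in> \<int>" unfolding \<Delta>_def using elim by (intro Ints_diff) auto
    then obtain k where k: "\<Delta> p e = of_int k" using Ints_cases by blast
    have "norm (of_int (k - 1) :: complex) < 1" using elim(2) unfolding k dist_norm by simp
    then have "k = 1" by (simp only: norm_of_int)
    then show ?case using k unfolding \<Delta>_def by (simp add: algebra_simps)
  qed
qed

section \<open>Total winding number and its parity\<close>

context diagram
begin

definition component_path :: "nat \<Rightarrow> real \<Rightarrow> complex" where
  "component_path i t = shadow D (i, t)"

lemma component_path:
  assumes "i < length D"
  shows "path (component_path i)" "pathfinish (component_path i) = pathstart (component_path i)"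
    "path_image (component_path i) = range (component_path i)"
    "path_image (component_path i) \<subseteq> curve"
proof -
  show "path (component_path i)"
    unfolding path_def component_path_def by (rule continuous_shadow[OF assms])
  show "pathfinish (component_path i) = pathstart (component_path i)"
    unfolding pathfinish_def pathstart_def component_path_def
    using shadow_periodic[OF assms, of 1 0] by simp
  show "path_image (component_path i) \<subseteq> curve"
    unfolding path_image_def component_path_def using shadow_in_curve[OF assms] by auto
  have "component_path i t \<in> component_path i ` {0..1}" for t
    unfolding component_path_def at_frac(2)[OF assms, of t, symmetric]
    using frac_lt_1[of t] by (intro imageI) (auto simp: less_imp_le)
  then show "path_image (component_path i) = range (component_path i)"
    unfolding path_image_def by auto
qed

lemma winding_number_jump_component:
  assumes i: "i < length D" "simple i t"
  shows "\<forall>\<^sub>F e in at_right 0.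
    winding_number (component_path i) (shadow D (i, t) + e *\<^sub>R (\<i> * tangent D (i, t))) =
    winding_number (component_path i) (shadow D (i, t) + e *\<^sub>R (- \<i> * tangent D (i, t))) + 1"
proof -
  let ?T = "tangent D (i, t)" and ?z = "shadow D (i, t)"
  \<comment> \<open>Starting half a period earlier puts the passage at the interior parameter 1/2;
    the base point of \<open>component_path i\<close> could be the point itself.\<close>
  define a where "a = frac (t - 1/2)"
  have a: "a \<in> {0..1}" unfolding a_def using frac_lt_1[of "t - 1/2"] by (auto simp: less_imp_le)
  define q where "q x = shadow D (i, t - 1/2 + x)" for x
  have q_eq: "q x = component_path i (a + x)" for x
    unfolding q_def component_path_def a_def
    using shadow_periodic[OF i(1) frac_shift(1)[of "t - 1/2"], of "t - 1/2 + x"] by (simp add: algebra_simps)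
  have shift: "shiftpath a (component_path i) = q"
    unfolding shiftpath_def q_eq component_path_def
    using shadow_periodic[OF i(1), of "-1"] by (auto simp: fun_eq_iff)
  have "path_image q = path_image (component_path i)"
    unfolding shift[symmetric] using path_image_shiftpath[OF a component_path(2)[OF i(1)]] .
  have wn: "winding_number q w = winding_number (component_path i) w" if "w \<notin> path_image (component_path i)" for w
    unfolding shift[symmetric] using component_path[OF i(1)] a that by (intro winding_number_shiftpath) auto
  have T: "?T \<noteq> 0" by (rule tangent_nonzero[OF i(1)])
  have "0 < cross ?T (\<i> * ?T)" using T by (simp add: cross_ii)
  then have "{\<i> * ?T, - \<i> * ?T} \<subseteq> sector i t 1" using sector_simple[OF i] by (auto simp: cross_simps)
  then obtain \<delta> where \<delta>: "0 < \<delta>" "\<And>h e d. \<lbrakk>0 \<le> h; h < \<delta>; 0 < e; e < \<delta>; d \<in> {\<i> * ?T, - \<i> * ?T}\<rbrakk> \<Longrightarrow>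
      shadow D (i, t + 1 * h) + e *\<^sub>R d \<notin> curve"
    using off_curve[OF i(1), of 1 "{\<i> * ?T, - \<i> * ?T}" t] by auto
  have off: "\<forall>\<^sub>F e in at_right 0. ?z + e *\<^sub>R (\<i> * ?T) \<notin> curve \<and> ?z + e *\<^sub>R (- \<i> * ?T) \<notin> curve"
    using eventually_at_right_0_less[OF \<delta>(1)] by eventually_elim (use \<delta>(2)[of 0] in force)
  have "\<forall>\<^sub>F e in at_right 0. winding_number q (?z + e *\<^sub>R (\<i> * ?T)) = winding_number q (?z + e *\<^sub>R (- \<i> * ?T)) + 1"
  proof (rule winding_number_jump[where c="1/2"])
    show "path q" "pathfinish q = pathstart q"
      unfolding shift[symmetric] using component_path[OF i(1)] a
      by (auto intro: path_shiftpath closed_shiftpath)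
    show "q x = ?z \<longleftrightarrow> x = 1/2" if x: "x \<in> {0..1}" for x
    proof
      assume "q x = ?z"
      then have "(t - 1/2 + x) - t \<in> \<int>" using simpleD(2)[OF i i(1)] unfolding q_def by blast
      then obtain k where "(t - 1/2 + x) - t = of_int k" using Ints_cases by blast
      then have k: "x - 1/2 = of_int k" by simp
      then have "real_of_int k < 1" "-1 < real_of_int k" using x by auto
      then have "k = 0" by linarith
      then show "x = 1/2" using k by simp
    next
      assume x: "x = 1/2"
      show "q x = ?z" unfolding x q_def by simp
    qed
    have "((\<lambda>x. t - 1/2 + x) has_vector_derivative 1) (at (1/2))"
      unfolding has_real_derivative_iff_has_vector_derivative[symmetric]
      by (auto intro!: derivative_eq_intros)
    from vector_diff_chain_at[OF this, of "\<lambda>t. shadow D (i, t)" ?T] shadow_derivative(1)[OF i(1), of t]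
    show "(q has_vector_derivative ?T) (at (1/2))" by (simp add: o_def q_def[abs_def])
    show "\<forall>\<^sub>F e in at_right 0. ?z + e *\<^sub>R (\<i> * ?T) \<notin> path_image q \<and> ?z + e *\<^sub>R (- \<i> * ?T) \<notin> path_image q"
      using off \<open>path_image q = _\<close> component_path(4)[OF i(1)] by (auto elim!: eventually_mono)
  qed (use T in auto)
  with off show ?thesis
  proof eventually_elim
    case (elim e)
    have *: "winding_number q w = winding_number (component_path i) w" if "w \<notin> curve" for w
      using wn that component_path(4)[OF i(1)] by blast
    show ?case
      using elim(2) unfolding *[OF conjunct1[OF elim(1)]] *[OF conjunct2[OF elim(1)]] .
  qed
qed

definition total_winding :: "complex \<Rightarrow> complex" where
  "total_winding w = (\<Sum>i<length D. winding_number (component_path i) w)"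

lemma total_winding_integer: "w \<notin> curve \<Longrightarrow> total_winding w \<in> \<int>"
  unfolding total_winding_def using component_path integer_winding_number_eq by (intro Ints_sum) blast

text \<open>No other component passes through a simple point, so all other winding numbers are
  constant nearby.\<close>

lemma total_winding_jump:
  assumes i: "i < length D" "simple i t"
  shows "\<forall>\<^sub>F e in at_right 0.
    total_winding (shadow D (i, t) + e *\<^sub>R (\<i> * tangent D (i, t))) =
    total_winding (shadow D (i, t) + e *\<^sub>R (- \<i> * tangent D (i, t))) + 1"
proof -
  let ?z = "shadow D (i, t)" and ?T = "tangent D (i, t)"
  have "\<forall>\<^sub>F e in at_right 0. winding_number (component_path j) (?z + e *\<^sub>R w) = winding_number (component_path j) ?z"
    if j: "j < length D" "j \<noteq> i" for j w
  proof -
    have "?z \<notin> path_image (component_path j)"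
      using simpleD(1)[OF i j(1)] j(2) unfolding path_image_def component_path_def by force
    then have "?z \<in> - path_image (component_path j)" "open (- path_image (component_path j))"
      using component_path(1)[OF j(1)] by (auto simp: closed_path_image open_Compl)
    then obtain r where r: "0 < r" "ball ?z r \<subseteq> - path_image (component_path j)"
      using open_contains_ball by blast
    have "((\<lambda>e. ?z + e *\<^sub>R w) \<longlongrightarrow> ?z) (at_right 0)" by (auto intro!: tendsto_eq_intros)
    then have "\<forall>\<^sub>F e in at_right 0. ?z + e *\<^sub>R w \<in> ball ?z r"
      using r(1) by (auto dest: tendstoD simp: dist_commute)
    then show ?thesis
    proof eventually_elim
      case (elim e)
      show ?case
        by (rule winding_number_eq[OF component_path(1,2)[OF j(1)] elim]) (use r in auto)
    qed
  qed
  note const = this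
  have "\<forall>\<^sub>F e in at_right 0. winding_number (component_path j) (?z + e *\<^sub>R (\<i> * ?T))
      = winding_number (component_path j) (?z + e *\<^sub>R (- \<i> * ?T))" if j: "j < length D" "j \<noteq> i" for j
    using const[OF j, of "\<i> * ?T"] const[OF j, of "- \<i> * ?T"] by eventually_elim simp
  then have "\<forall>\<^sub>F e in at_right 0. \<forall>j\<in>{..<length D} - {i}.
      winding_number (component_path j) (?z + e *\<^sub>R (\<i> * ?T)) = winding_number (component_path j) (?z + e *\<^sub>R (- \<i> * ?T))"
    by (intro eventually_ball_finite ballI) auto
  with winding_number_jump_component[OF i] show ?thesis
  proof eventually_elim
    case (elim e)
    have "total_winding w = winding_number (component_path i) w + (\<Sum>j\<in>{..<length D} - {i}. winding_number (component_path j) w)" for w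
      unfolding total_winding_def using i(1) by (intro sum.remove) auto
    then show ?case using elim by simp
  qed
qed

definition odd_regions :: "complex set set" where
  "odd_regions = {R \<in> regions D. \<exists>w\<in>R. \<exists>k. odd k \<and> total_winding w = of_int k}"

lemma region_avoids_curve: "R \<in> regions D \<Longrightarrow> connected R \<and> R \<inter> curve = {}"
  unfolding regions_def curve_def[symmetric]
  using in_components_subset in_components_connected by blast

text \<open>Winding numbers are constant on a connected set off the curve, so any point of the
  region decides. They are complex-valued, hence the detour over \<open>of_int k\<close>.\<close>

lemma odd_regions_iff:
  assumes "R \<in> regions D" "w \<in> R"
  shows "R \<in> odd_regions \<longleftrightarrow> (\<exists>k. odd k \<and> total_winding w = of_int k)"
proof -
  have same: "total_winding w = total_winding v" if "v \<in> R" for v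
    unfolding total_winding_def
  proof (intro sum.cong refl)
    fix i assume "i \<in> {..<length D}"
    then show "winding_number (component_path i) w = winding_number (component_path i) v"
      using component_path[of i] region_avoids_curve[OF assms(1)] assms(2) that
      by (intro winding_number_eq[where S=R]) auto
  qed
  have "R \<in> odd_regions \<longleftrightarrow> (\<exists>v\<in>R. \<exists>k. odd k \<and> total_winding v = of_int k)"
    unfolding odd_regions_def using assms(1) by simp
  also have "\<dots> \<longleftrightarrow> (\<exists>v\<in>R. \<exists>k. odd k \<and> total_winding w = of_int k)"
    by (intro bex_cong refl) (simp only: same)
  finally show ?thesis using assms(2) by blast
qed

lemma total_winding_zero_at_infinity: "\<exists>M. \<forall>w. M \<le> norm w \<longrightarrow> total_winding w = 0"
proof -
  have "\<forall>i. \<exists>M. i < length D \<longrightarrow> (\<forall>w. M \<le> norm w \<longrightarrow> winding_number (component_path i) w = 0)"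
    using winding_number_zero_at_infinity component_path by metis
  then obtain M where M: "\<And>i w. i < length D \<Longrightarrow> M i \<le> norm w \<Longrightarrow> winding_number (component_path i) w = 0"
    by metis
  have "M i \<le> (\<Sum>j<length D. \<bar>M j\<bar>)" if "i < length D" for i
    using member_le_sum[of i "{..<length D}" "\<lambda>j. \<bar>M j\<bar>"] that by fastforce
  then show ?thesis
    unfolding total_winding_def by (intro exI[of _ "\<Sum>j<length D. \<bar>M j\<bar>"] allI impI sum.neutral) (force intro: M)
qed

text \<open>The exterior is white because an unbounded region reaches points of total winding 0,
  which is even.\<close>

lemma checkerboard_exists: "checkerboard D odd_regions"
  unfolding checkerboard_def
proof (intro conjI ballI impI)
  show "odd_regions \<subseteq> regions D" unfolding odd_regions_def by auto
  show "bounded R" if R: "R \<in> odd_regions" for R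
  proof (rule ccontr)
    assume "\<not> bounded R"
    obtain M where M: "\<And>w. M \<le> norm w \<Longrightarrow> total_winding w = 0" using total_winding_zero_at_infinity by blast
    obtain w where w: "w \<in> R" "M \<le> norm w"
      using \<open>\<not> bounded R\<close> unfolding bounded_iff by (meson linear)
    have "R \<in> regions D" using R unfolding odd_regions_def by simp
    from odd_regions_iff[OF this w(1)] R M[OF w(2)] show False by auto
  qed
  fix p assume p: "p \<in> params D" and alone: "\<forall>q\<in>params D. shadow D q = shadow D p \<longrightarrow> q = p"
  obtain i t where it: "p = (i, t)" by (metis surj_pair)
  have i: "i < length D" and frac: "frac t = t" using p it frac_of_param by (auto simp: params_def)
  have "\<not> crossing_point p"
  proof
    assume "crossing_point p"
    then obtain q where "(p, q) \<in> crossings D \<or> (q, p) \<in> crossings D" unfolding crossing_point_def by force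
    then show False using alone crossingsD(1-4)[of p q] crossingsD(1-4)[of q p] by (metis less_irrefl)
  qed
  then have s: "simple i t" using it frac by simp
  let ?z = "shadow D (i, t)" and ?T = "tangent D (i, t)"
  have pos: "0 < cross ?T (\<i> * ?T)" using tangent_nonzero[OF i] by (simp add: cross_ii)
  have germ: "\<forall>\<^sub>F e in at_right 0. ?z + e *\<^sub>R d \<in> region_towards D ?z d" "region_towards D ?z d \<in> regions D"
    if "d = \<i> * ?T \<or> d = - \<i> * ?T" for d
  proof -
    have "0 < cross ?T d * cross ?T d" using that pos by (auto simp: cross_simps)
    from region_same_side(2,3)[OF i s this]
    show "\<forall>\<^sub>F e in at_right 0. ?z + e *\<^sub>R d \<in> region_towards D ?z d" "region_towards D ?z d \<in> regions D" .
  qed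
  have "\<forall>\<^sub>F e in at_right 0. ?z + e *\<^sub>R (\<i> * ?T) \<in> region_towards D ?z (\<i> * ?T) \<and>
      ?z + e *\<^sub>R (- \<i> * ?T) \<in> region_towards D ?z (- \<i> * ?T) \<and>
      total_winding (?z + e *\<^sub>R (\<i> * ?T)) = total_winding (?z + e *\<^sub>R (- \<i> * ?T)) + 1"
    using germ(1)[of "\<i> * ?T"] germ(1)[of "- \<i> * ?T"] total_winding_jump[OF i s] by (intro eventually_conj) blast+
  then obtain e where e: "?z + e *\<^sub>R (\<i> * ?T) \<in> region_towards D ?z (\<i> * ?T)"
      "?z + e *\<^sub>R (- \<i> * ?T) \<in> region_towards D ?z (- \<i> * ?T)"
      "total_winding (?z + e *\<^sub>R (\<i> * ?T)) = total_winding (?z + e *\<^sub>R (- \<i> * ?T)) + 1"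
    using eventually_happens'[OF trivial_limit_at_right_real] by blast
  have R: "region_towards D ?z (\<i> * ?T) \<in> regions D" "region_towards D ?z (- \<i> * ?T) \<in> regions D"
    using germ(2) by auto
  then have "?z + e *\<^sub>R (- \<i> * ?T) \<notin> curve" using region_avoids_curve e(2) by blast
  then obtain k where k: "total_winding (?z + e *\<^sub>R (- \<i> * ?T)) = of_int k"
    using total_winding_integer Ints_cases by metis
  then have k': "total_winding (?z + e *\<^sub>R (\<i> * ?T)) = of_int (k + 1)" using e(3) by simp
  have "region_towards D ?z (\<i> * ?T) \<in> odd_regions \<longleftrightarrow> odd (k + 1)"
    unfolding odd_regions_iff[OF R(1) e(1)] k' by (metis of_int_eq_iff)
  moreover have "region_towards D ?z (- \<i> * ?T) \<in> odd_regions \<longleftrightarrow> odd k"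
    unfolding odd_regions_iff[OF R(2) e(2)] k by (metis of_int_eq_iff)
  ultimately show "(region_towards D (shadow D p) (\<i> * tangent D p) \<in> odd_regions) \<noteq>
        (region_towards D (shadow D p) (- \<i> * tangent D p) \<in> odd_regions)"
    unfolding it by simp
qed

text \<open>The colour statements hold for every checkerboard coloring, so existence passes them on
  to the chosen one.\<close>

lemma checkerboard_black: "checkerboard D (black D)"
  unfolding black_def using checkerboard_exists by (rule someI)

end

section \<open>Translating a coloring\<close>

text \<open>Restricted to \<open>arcs D\<close> because colorings are extensional functions;
  \<open>f\<close> is a parameter so that translation by \<open>qop\<close> and its inverse by
  \<open>qinv\<close> are both instances.\<close>

definition translate :: 
    "link \<Rightarrow> ('q \<Rightarrow> 'q \<Rightarrow> 'q) \<Rightarrow> 'q \<Rightarrow> ((complex \<times> real) set \<Rightarrow> 'q) \<Rightarrow> (complex \<times> real) set \<Rightarrow> 'q" where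
  "translate D f c C = (\<lambda>\<alpha>\<in>arcs D. f (C \<alpha>) c)"

context quandle
begin

text \<open>By self-distributivity \<open>a \<mapsto> a \<lhd> c\<close> is an automorphism, so its
  inverse is one as well.\<close>

lemma inv_distrib:
  assumes "a \<in> Q" "b \<in> Q" "c \<in> Q"
  shows "(a \<lhd> b) \<lhd>' c = (a \<lhd>' c) \<lhd> (b \<lhd>' c)"
proof -
  have "((a \<lhd>' c) \<lhd> (b \<lhd>' c)) \<lhd> c = a \<lhd> b"
    using assms self_distrib[of "a \<lhd>' c" "b \<lhd>' c" c] by (simp add: inv_closed inv_op)
  then show ?thesis
    using assms op_inv[of "(a \<lhd>' c) \<lhd> (b \<lhd>' c)" c] by (simp add: inv_closed op_closed)
qed

end

locale colored_diagram = diagram D + quandle Q qop qinv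
  for D :: link and Q :: "'q set" and qop qinv :: "'q \<Rightarrow> 'q \<Rightarrow> 'q"
begin

lemma coloringD:
  assumes "C \<in> colorings Q qop D"
  shows "\<alpha> \<in> arcs D \<Longrightarrow> C \<alpha> \<in> Q"
    and "x \<in> crossings D \<Longrightarrow> C (left_under_arc D x) = qop (C (right_under_arc D x)) (C (over_arc D x))"
  using assms unfolding colorings_def by (auto simp: PiE_iff)

lemma translate_coloring:
  assumes C: "C \<in> colorings Q qop D"
    and f: "\<And>a. a \<in> Q \<Longrightarrow> f a c \<in> Q"
    and distrib: "\<And>a b. a \<in> Q \<Longrightarrow> b \<in> Q \<Longrightarrow> f (qop a b) c = qop (f a c) (f b c)"
  shows "translate D f c C \<in> colorings Q qop D"
  using coloringD[OF C] crossing_arcs f distrib unfolding colorings_def translate_def by auto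

lemma bij_translate:
  assumes c: "c \<in> Q"
  shows "bij_betw (translate D qop c) (colorings Q qop D) (colorings Q qop D)"
proof (rule bij_betw_byWitness[where f' = "translate D qinv c"])
  have inv: "translate D f c (translate D g c C) = C"
    if "C \<in> colorings Q qop D" "\<And>a. a \<in> Q \<Longrightarrow> f (g a c) c = a" for f g C
    using that coloringD(1)[OF that(1)] unfolding translate_def colorings_def
    by (intro ext) (auto simp: PiE_iff extensional_def)
  show "\<forall>C\<in>colorings Q qop D. translate D qinv c (translate D qop c C) = C"
    using inv op_inv c by blast
  show "\<forall>C\<in>colorings Q qop D. translate D qop c (translate D qinv c C) = C"
    using inv inv_op c by blast
  show "translate D qop c ` colorings Q qop D \<subseteq> colorings Q qop D"
    using translate_coloring op_closed self_distrib c by blast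
  show "translate D qinv c ` colorings Q qop D \<subseteq> colorings Q qop D"
    using translate_coloring inv_closed inv_distrib c by blast
qed

lemma pos_weight_translate:
  fixes \<omega> :: "'q \<Rightarrow> 'q \<Rightarrow> 'a::ab_group_add"
  assumes \<omega>: "positive_2_cocycle Q qop \<omega>" and C: "C \<in> colorings Q qop D" and c: "c \<in> Q"
  shows "pos_weight \<omega> D (translate D qop c C) = - pos_weight \<omega> D C"
proof -
  let ?C = "translate D qop c C"
  define f where "f \<alpha> = \<omega> (C \<alpha>) c" for \<alpha>
  have cocycle: "\<omega> (qop a c) (qop b c) + \<omega> a b = \<omega> (qop a b) c + \<omega> a c - (\<omega> b c + \<omega> b c)"
    if "a \<in> Q" "b \<in> Q" for a b
    using \<omega> that c unfolding positive_2_cocycle_def by (simp add: algebra_simps)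
  have "pos_weight \<omega> D ?C + pos_weight \<omega> D C = (\<Sum>x\<in>crossings D.
    let v = f (left_under_arc D x) + f (right_under_arc D x) - (f (over_arc D x) + f (over_arc D x))
    in if pos_sign D x = 1 then v else - v)"
    unfolding pos_weight_def sum.distrib[symmetric]
  proof (intro sum.cong refl)
    fix x assume x: "x \<in> crossings D"
    let ?a = "C (right_under_arc D x)" and ?b = "C (over_arc D x)"
    \<comment> \<open>The coloring condition turns \<open>\<omega> (qop a b) c\<close> into
      \<open>f\<close> at the left under-arc, so the cocycle identity becomes the summand of
      \<open>alternating_sum_zero\<close>.\<close>
    have eq: "\<omega> (?C (right_under_arc D x)) (?C (over_arc D x)) + \<omega> ?a ?b
        = f (left_under_arc D x) + f (right_under_arc D x) - (f (over_arc D x) + f (over_arc D x))"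
      unfolding f_def coloringD(2)[OF C x]
      using cocycle[of ?a ?b] coloringD(1)[OF C] crossing_arcs[OF x] by (simp add: translate_def)
    show "(let v = \<omega> (?C (right_under_arc D x)) (?C (over_arc D x)) in if pos_sign D x = 1 then v else - v) +
        (let v = \<omega> ?a ?b in if pos_sign D x = 1 then v else - v) =
        (let v = f (left_under_arc D x) + f (right_under_arc D x) - (f (over_arc D x) + f (over_arc D x))
          in if pos_sign D x = 1 then v else - v)"
      unfolding Let_def eq[symmetric] by simp
  qed
  also have "\<dots> = 0" by (rule alternating_sum_zero[OF checkerboard_black])
  finally show ?thesis by (simp add: eq_neg_iff_add_eq_0)
qed

end

theorem proposition5p2:
  fixes Q :: "'q set"
    and qop qinv :: "'q \<Rightarrow> 'q \<Rightarrow> 'q"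
    and \<omega> :: "'q \<Rightarrow> 'q \<Rightarrow> 'a::ab_group_add"
    and D :: link
  assumes "quandle Q qop qinv"
    and "positive_2_cocycle Q qop \<omega>"
    and "link_diagram D"
  shows "same_multiset
           (colorings Q qop D) (\<lambda>C. pos_weight \<omega> D C)
           (colorings Q qop D) (\<lambda>C. - pos_weight \<omega> D C)"
proof -
  interpret colored_diagram D Q qop qinv
    by (intro colored_diagram.intro diagram.intro assms)
  \<comment> \<open>Any element serves as the translating one; nonemptiness of the quandle supplies
    it.\<close>
  obtain c where c: "c \<in> Q" using nonempty by blast
  show ?thesis
    unfolding same_multiset_def
    using bij_translate[OF c] pos_weight_translate[OF assms(2) _ c]
    by (intro exI[of _ "translate D qop c"]) auto
qed

end
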